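(* (i) Let $F : [0,\infty) \to [0,\infty)$. Then $F \circ \Lambda$ is a Pólya frequency function for every Pólya frequency function $\Lambda$ if and only if there is a constant $c > 0$ such that $F(x) = cx$ for all $x \geq 0$. (ii) Let $F : (0,\infty) \to (0,\infty)$. Then $F \circ \Lambda$ is a totally positive Pólya frequency function for every totally positive Pólya frequency function $\Lambda$ if and only if there is a constant $c > 0$ such that $F(x) = cx$ for all $x > 0$.
   Context: A Pólya frequency function is a function $\Lambda : \mathbb{R} \to [0,\infty)$ that is Lebesgue integrable, non-zero at two or more points, and such that the Toeplitz kernel $T_\Lambda : \mathbb{R} \times \mathbb{R} \to \mathbb{R}$, $T_\Lambda(x,y) = \Lambda(x-y)$, is totally non-negative, i.e. $\det(\Lambda(x_i-y_j))_{i,j=1}^n \geq 0$ for all $n \in \mathbb{N}$, $x_1 < \cdots < x_n$ and $y_1 < \cdots < y_n$. It is totally positive if all these determinants are strictly positive (in particular, then $\Lambda > 0$ everywhere). *)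

theory Defs
  imports "HOL-Analysis.Analysis" "Jordan_Normal_Form.Determinant"
begin

text \<open>
  The size of the minors varies, so determinants are those of Jordan_Normal_Form
  (\<open>Determinant.det\<close>, \<open>Matrix.mat\<close>), not the type-indexed ones of HOL-Analysis.
  Indices run over \<open>0, \<dots>, n - 1\<close>; only the values of \<open>x\<close> and \<open>y\<close> there matter.
\<close>

definition kernel_matrix ::
    "(real \<Rightarrow> real \<Rightarrow> real) \<Rightarrow> nat \<Rightarrow> (nat \<Rightarrow> real) \<Rightarrow> (nat \<Rightarrow> real) \<Rightarrow> real Matrix.mat" where
  "kernel_matrix K n x y = Matrix.mat n n (\<lambda>(i, j). K (x i) (y j))"

definition totally_nonneg_kernel :: "(real \<Rightarrow> real \<Rightarrow> real) \<Rightarrow> bool" where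
  "totally_nonneg_kernel K \<longleftrightarrow>
     (\<forall>n\<ge>1. \<forall>x y. strict_mono_on {..<n} x \<and> strict_mono_on {..<n} y \<longrightarrow>
        Determinant.det (kernel_matrix K n x y) \<ge> 0)"

definition totally_positive_kernel :: "(real \<Rightarrow> real \<Rightarrow> real) \<Rightarrow> bool" where
  "totally_positive_kernel K \<longleftrightarrow>
     (\<forall>n\<ge>1. \<forall>x y. strict_mono_on {..<n} x \<and> strict_mono_on {..<n} y \<longrightarrow>
        Determinant.det (kernel_matrix K n x y) > 0)"

definition toeplitz_kernel :: "(real \<Rightarrow> real) \<Rightarrow> real \<Rightarrow> real \<Rightarrow> real" where
  "toeplitz_kernel \<Lambda> x y = \<Lambda> (x - y)"

definition polya_frequency :: "(real \<Rightarrow> real) \<Rightarrow> bool" where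
  "polya_frequency \<Lambda> \<longleftrightarrow>
     (\<forall>x. \<Lambda> x \<ge> 0) \<and>
     integrable lebesgue \<Lambda> \<and>
     (\<exists>a b. a \<noteq> b \<and> \<Lambda> a \<noteq> 0 \<and> \<Lambda> b \<noteq> 0) \<and>
     totally_nonneg_kernel (toeplitz_kernel \<Lambda>)"

definition totally_positive_polya_frequency :: "(real \<Rightarrow> real) \<Rightarrow> bool" where
  "totally_positive_polya_frequency \<Lambda> \<longleftrightarrow>
     polya_frequency \<Lambda> \<and> totally_positive_kernel (toeplitz_kernel \<Lambda>)"

end

theory Submission
  imports Defs "HOL-Real_Asymp.Real_Asymp"
begin

text \<open>
  Only composition with three explicit totally positive functions is needed.  Composing with the
  Gaussians \<open>c exp (- x\<^sup>2)\<close> shows that \<open>F\<close> is monotone, positive and continuous on \<open>(0, \<infinity>)\<close>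
  and tends to 0 at 0.  The functions \<open>c exp (- x) (1 - exp (- exp (q x)))\<close> converge for
  \<open>q \<rightarrow> \<infinity>\<close> to one-sided exponentials, so \<open>F (c exp (- x))\<close>, cut off at \<open>x = 0\<close>, is
  totally nonnegative; its minors of order two make it log-concave, and a minor of order three
  across the jump makes it log-convex.  Hence \<open>F u = F 1 * u powr \<alpha>\<close> with \<open>\<alpha> > 0\<close>.

  Finally, if a totally nonnegative function behaves like \<open>\<Sum>k. p k * exp (- \<mu> k * x)\<close> at
  \<open>\<infinity>\<close>, the signs of the \<open>p k\<close> must alternate.  For a suitable smoothed convolution of three
  exponentials this fails for its \<open>\<alpha>\<close>-th power unless \<open>\<alpha> = 1\<close>.

  Total positivity of the test functions comes from a single principle: if every minor of the
  kernel \<open>h' j (x i)\<close> is positive, integrating its rows one after the other from the point of the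
  preceding row preserves positivity.
\<close>

section \<open>Minors of antiderivatives\<close>

definition ndet :: "nat \<Rightarrow> (nat \<Rightarrow> nat \<Rightarrow> real) \<Rightarrow> real" where
  "ndet n a = Determinant.det (Matrix.mat n n (\<lambda>(i, j). a i j))"

lemma det_kernel_matrix: "Determinant.det (kernel_matrix K n x y) = ndet n (\<lambda>i j. K (x i) (y j))"
  by (simp add: ndet_def kernel_matrix_def)

lemma ndet_cong:
  assumes "\<And>i j. i < n \<Longrightarrow> j < n \<Longrightarrow> a i j = b i j"
  shows "ndet n a = ndet n b"
  unfolding ndet_def by (rule arg_cong[where f = Determinant.det], rule eq_matI) (auto simp: assms)

lemma ndet_0 [simp]: "ndet 0 a = 1"
  by (simp add: ndet_def)

lemma ndet_Leibniz:
  "ndet n a = (\<Sum>p | p permutes {0..<n}. signof p * (\<Prod>i = 0..<n. a i (p i)))"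
proof -
  have "Determinant.det (Matrix.mat n n (\<lambda>(i, j). a i j)) =
      (\<Sum>p | p permutes {0..<n}. signof p * (\<Prod>i = 0..<n. Matrix.mat n n (\<lambda>(i, j). a i j) $$ (i, p i)))"
    by (rule det_def') simp
  also have "\<dots> = (\<Sum>p | p permutes {0..<n}. signof p * (\<Prod>i = 0..<n. a i (p i)))"
  proof (intro sum.cong refl arg_cong2[where f = "(*)"] prod.cong)
    fix p i assume "p \<in> {p. p permutes {0..<n}}" "i \<in> {0..<n}"
    then have "p i \<in> {0..<n}" by (metis mem_Collect_eq permutes_in_image)
    with \<open>i \<in> _\<close> show "Matrix.mat n n (\<lambda>(i, j). a i j) $$ (i, p i) = a i (p i)" by simp
  qed
  finally show ?thesis by (simp add: ndet_def)
qed

lemma ndet_scale: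
  "ndet n (\<lambda>i j. r i * c j * a i j) = (\<Prod>i<n. r i) * (\<Prod>j<n. c j) * ndet n a"
proof -
  have "signof p * (\<Prod>i = 0..<n. r i * c (p i) * a i (p i)) =
      (\<Prod>i<n. r i) * (\<Prod>j<n. c j) * (signof p * (\<Prod>i = 0..<n. a i (p i)))"
    if "p permutes {0..<n}" for p
  proof -
    have "(\<Prod>i = 0..<n. c (p i)) = (\<Prod>j = 0..<n. c j)"
      using prod.permute[OF that, of c] by (simp add: o_def)
    then show ?thesis by (simp add: prod.distrib atLeast0LessThan)
  qed
  then show ?thesis
    unfolding ndet_Leibniz sum_distrib_left by (intro sum.cong) auto
qed

lemma tendsto_ndet:
  assumes "\<And>i j. i < n \<Longrightarrow> j < n \<Longrightarrow> ((\<lambda>t. a t i j) \<longlongrightarrow> b i j) F"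
  shows "((\<lambda>t. ndet n (a t)) \<longlongrightarrow> ndet n b) F"
  unfolding ndet_Leibniz
proof (intro tendsto_sum tendsto_mult tendsto_const tendsto_prod assms)
  fix p i assume "p \<in> {p. p permutes {0..<n}}" "i \<in> {0..<n}"
  then show "i < n" "p i < n" by (auto dest: permutes_in_image[of _ _ i])
qed

lemma ndet_identical_rows:
  assumes "i < n" "k < n" "i \<noteq> k" "\<And>j. j < n \<Longrightarrow> a i j = a k j"
  shows "ndet n a = 0"
  unfolding ndet_def
  by (rule det_identical_rows[of _ n i k]) (auto simp: assms intro!: eq_vecI)

text \<open>The \<open>c j\<close> are the cofactors along row \<open>k\<close>, which do not see
  that row. This form makes derivatives and limits in a single row immediate.\<close>

lemma ndet_row_linear:
  assumes "k < n"
  shows "\<exists>c. \<forall>r. ndet n (a(k := r)) = (\<Sum>j<n. r j * c j)"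
proof -
  define M where "M r = Matrix.mat n n (\<lambda>(i, j). (a(k := r)) i j)" for r
  have "cofactor (M r) k j = cofactor (M (a k)) k j" if "j < n" for r j
    unfolding cofactor_def
    by (rule arg_cong[where f = "\<lambda>A. _ * Determinant.det A"], rule eq_matI)
       (use assms that in \<open>auto simp: M_def mat_delete_def\<close>)
  then have "ndet n (a(k := r)) = (\<Sum>j<n. r j * cofactor (M (a k)) k j)" for r
    using laplace_expansion_row[of "M r" n k] assms by (simp add: M_def ndet_def)
  then show ?thesis by blast
qed

lemma ndet_Suc:
  "ndet (Suc n) a =
     (\<Sum>j<Suc n. (-1) ^ j * a 0 j * ndet n (\<lambda>i k. a (Suc i) (if k < j then k else Suc k)))"
proof -
  define M where "M = Matrix.mat (Suc n) (Suc n) (\<lambda>(i, j). a i j)"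
  have "ndet (Suc n) a = (\<Sum>j<Suc n. M $$ (0, j) * cofactor M 0 j)"
    unfolding ndet_def M_def by (rule laplace_expansion_row) auto
  also have "\<dots> = (\<Sum>j<Suc n. (-1) ^ j * a 0 j * ndet n (\<lambda>i k. a (Suc i) (if k < j then k else Suc k)))"
  proof (rule sum.cong)
    fix j assume "j \<in> {..<Suc n}"
    moreover have "mat_delete M 0 j = Matrix.mat n n (\<lambda>(i, k). a (Suc i) (if k < j then k else Suc k))"
      by (rule eq_matI) (auto simp: M_def mat_delete_def)
    ultimately show "M $$ (0, j) * cofactor M 0 j =
        (-1) ^ j * a 0 j * ndet n (\<lambda>i k. a (Suc i) (if k < j then k else Suc k))"
      by (simp add: M_def ndet_def cofactor_def)
  qed simp
  finally show ?thesis .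
qed

lemma ndet_corner:
  assumes "\<And>i. i < n \<Longrightarrow> a (Suc i) 0 = 0"
  shows "ndet (Suc n) a = a 0 0 * ndet n (\<lambda>i j. a (Suc i) (Suc j))"
proof -
  define M where "M = Matrix.mat (Suc n) (Suc n) (\<lambda>(i, j). a i j)"
  have "ndet (Suc n) a = (\<Sum>i<Suc n. M $$ (i, 0) * cofactor M i 0)"
    unfolding ndet_def M_def by (rule laplace_expansion_column) auto
  also have "\<dots> = M $$ (0, 0) * cofactor M 0 0"
    by (subst sum.lessThan_Suc_shift) (simp add: M_def assms)
  also have "mat_delete M 0 0 = Matrix.mat n n (\<lambda>(i, j). a (Suc i) (Suc j))"
    by (rule eq_matI) (auto simp: M_def mat_delete_def)
  then have "M $$ (0, 0) * cofactor M 0 0 = a 0 0 * ndet n (\<lambda>i j. a (Suc i) (Suc j))"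
    by (simp add: M_def ndet_def cofactor_def)
  finally show ?thesis .
qed

lemma ndet_1: "ndet (Suc 0) a = a 0 0"
  by (simp add: ndet_Suc)

lemma ndet_2: "ndet 2 a = a 0 0 * a 1 1 - a 0 1 * a 1 0"
  by (simp add: numeral_2_eq_2 ndet_Suc)

lemma ndet_3: "ndet 3 a = a 0 0 * (a 1 1 * a 2 2 - a 1 2 * a 2 1)
    - a 0 1 * (a 1 0 * a 2 2 - a 1 2 * a 2 0) + a 0 2 * (a 1 0 * a 2 1 - a 1 1 * a 2 0)"
  by (simp add: numeral_2_eq_2 numeral_3_eq_3 ndet_Suc algebra_simps)

lemma strict_mono_on_fun_upd:
  fixes x :: "nat \<Rightarrow> real"
  assumes "strict_mono_on {..<n} x" "\<And>i. i < k \<Longrightarrow> i < n \<Longrightarrow> x i < s" "\<And>i. k < i \<Longrightarrow> i < n \<Longrightarrow> s < x i"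
  shows "strict_mono_on {..<n} (x(k := s))"
  using assms unfolding strict_mono_on_def by auto

text \<open>Induction on the number \<open>k\<close> of integrated rows. As a function of the point
  \<open>s\<close> of row \<open>k\<close>, the determinant vanishes at \<open>x (k - 1)\<close>,
  where two rows coincide, and its derivative is the preceding minor at the points
  \<open>x(k := s)\<close>, hence positive up to \<open>x k\<close>.\<close>

lemma ndet_antiderivative_rows_from:
  fixes h h' :: "nat \<Rightarrow> real \<Rightarrow> real"
  assumes der: "\<And>j s. j < n \<Longrightarrow> (h j has_real_derivative h' j s) (at s)"
    and "0 < m"
    and base: "\<And>x. strict_mono_on {..<n} x \<Longrightarrow>
      0 < ndet n (\<lambda>i j. if i < m then h j (x i) else h' j (x i))"
    and x: "strict_mono_on {..<n} x"
  shows "0 < ndet n (\<lambda>i j. h j (x i))"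
proof -
  have "0 < ndet n (\<lambda>i j. if i < k then h j (x i) else h' j (x i))"
    if "m \<le> k" "strict_mono_on {..<n} x" for k x
    using that
  proof (induction k arbitrary: x rule: dec_induct)
    case base
    then show ?case by (rule assms(3))
  next
    case (step k)
    show ?case
    proof (cases "k < n")
      case False
      have "ndet n (\<lambda>i j. if i < Suc k then h j (x i) else h' j (x i))
          = ndet n (\<lambda>i j. if i < k then h j (x i) else h' j (x i))"
        using False by (intro ndet_cong) auto
      then show ?thesis using step by simp
    next
      case True
      define R where "R = (\<lambda>i j. if i < k then h j (x i) else h' j (x i))"
      obtain c where c: "\<And>r. ndet n (R(k := r)) = (\<Sum>j<n. r j * c j)"
        using ndet_row_linear[OF True, of R] by blast
      define G where "G s = ndet n (R(k := (\<lambda>j. h j s)))" for s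
      have k: "k - 1 < k" using \<open>0 < m\<close> \<open>m \<le> k\<close> by simp
      have "G (x (k - 1)) < G (x k)"
      proof (rule DERIV_pos_imp_increasing_open[of "x (k - 1)" "x k" G])
        show lt: "x (k - 1) < x k"
          using step.prems True k by (auto simp: strict_mono_on_def)
        have dG: "(G has_real_derivative ndet n (R(k := (\<lambda>j. h' j s)))) (at s)" for s
          unfolding G_def c by (intro DERIV_sum DERIV_cmult_right der) auto
        show "\<exists>y. (G has_real_derivative y) (at s) \<and> 0 < y"
          if s: "x (k - 1) < s" "s < x k" for s
        proof (intro exI conjI)
          show "(G has_real_derivative ndet n (R(k := (\<lambda>j. h' j s)))) (at s)" by (rule dG)
          have "strict_mono_on {..<n} (x(k := s))"
          proof (rule strict_mono_on_fun_upd[OF step.prems])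
            fix i assume i: "i < k" "i < n"
            then have "i = k - 1 \<or> i < k - 1" by linarith
            then have "x i \<le> x (k - 1)"
              using strict_mono_onD[OF step.prems, of i "k - 1"] i less_trans[OF k True] by auto
            then show "x i < s" using s by simp
          next
            fix i assume i: "k < i" "i < n"
            then have "x k < x i" using step.prems by (auto simp: strict_mono_on_def)
            then show "s < x i" using s by simp
          qed
          then have "0 < ndet n (\<lambda>i j. if i < k then h j ((x(k := s)) i) else h' j ((x(k := s)) i))"
            by (rule step.IH)
          also have "\<dots> = ndet n (R(k := (\<lambda>j. h' j s)))"
            by (rule ndet_cong) (auto simp: R_def)
          finally show "0 < \<dots>" .
        qed
        show "continuous_on {x (k - 1)..x k} G"
          by (meson dG continuous_at_imp_continuous_on DERIV_isCont)
      qed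
      moreover have "G (x (k - 1)) = 0"
        unfolding G_def by (rule ndet_identical_rows[of "k - 1" n k]) (use k True in \<open>auto simp: R_def\<close>)
      moreover have "G (x k) = ndet n (\<lambda>i j. if i < Suc k then h j (x i) else h' j (x i))"
        unfolding G_def by (rule ndet_cong) (auto simp: R_def less_Suc_eq)
      ultimately show ?thesis by simp
    qed
  qed
  from this[of "max m n" x] have "0 < ndet n (\<lambda>i j. if i < max m n then h j (x i) else h' j (x i))"
    using x by simp
  also have "\<dots> = ndet n (\<lambda>i j. h j (x i))"
    by (rule ndet_cong) auto
  finally show ?thesis .
qed

text \<open>Row 0 has no predecessor and is integrated from minus infinity, where \<open>lim\<close>
  makes the determinant vanish.\<close>

lemma ndet_antiderivative_rows:
  fixes h h' :: "nat \<Rightarrow> real \<Rightarrow> real"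
  assumes der: "\<And>j s. j < n \<Longrightarrow> (h j has_real_derivative h' j s) (at s)"
    and lim: "\<And>j. j < n \<Longrightarrow> (h j \<longlongrightarrow> 0) at_bot"
    and pos: "\<And>x. strict_mono_on {..<n} x \<Longrightarrow> 0 < ndet n (\<lambda>i j. h' j (x i))"
    and x: "strict_mono_on {..<n} x"
  shows "0 < ndet n (\<lambda>i j. h j (x i))"
proof (cases "n = 0")
  case False
  show ?thesis
  proof (rule ndet_antiderivative_rows_from[where m = 1, OF der])
    fix x :: "nat \<Rightarrow> real" assume x: "strict_mono_on {..<n} x"
    define R where "R = (\<lambda>i j. h' j (x i))"
    obtain c where c: "\<And>r. ndet n (R(0 := r)) = (\<Sum>j<n. r j * c j)"
      using ndet_row_linear[of 0 n R] False by blast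
    define G where "G s = ndet n (R(0 := (\<lambda>j. h j s)))" for s
    have dG: "(G has_real_derivative ndet n (R(0 := (\<lambda>j. h' j s)))) (at s)" for s
      unfolding G_def c by (intro DERIV_sum DERIV_cmult_right der) auto
    have inc: "G s < G t" if "s < t" "t \<le> x 0" for s t
    proof (rule DERIV_pos_imp_increasing_open[OF \<open>s < t\<close>])
      show "\<exists>y. (G has_real_derivative y) (at r) \<and> 0 < y" if r: "s < r" "r < t" for r
      proof (intro exI conjI)
        show "(G has_real_derivative ndet n (R(0 := (\<lambda>j. h' j r)))) (at r)" by (rule dG)
        have "strict_mono_on {..<n} (x(0 := r))"
        proof (rule strict_mono_on_fun_upd[OF x])
          fix i assume i: "0 < i" "i < n"
          then have "x 0 < x i" using x by (auto simp: strict_mono_on_def)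
          then show "r < x i" using r \<open>t \<le> x 0\<close> by simp
        qed simp
        then have "0 < ndet n (\<lambda>i j. h' j ((x(0 := r)) i))"
          by (rule pos)
        also have "\<dots> = ndet n (R(0 := (\<lambda>j. h' j r)))"
          by (rule ndet_cong) (auto simp: R_def)
        finally show "0 < \<dots>" .
      qed
      show "continuous_on {s..t} G"
        by (meson dG continuous_at_imp_continuous_on DERIV_isCont)
    qed
    have "(G \<longlongrightarrow> (\<Sum>j<n. 0 * c j)) at_bot"
      unfolding G_def c by (intro tendsto_intros lim) auto
    \<comment> \<open>The limit only yields a weak inequality; the intermediate point
      \<open>x 0 - 1\<close> restores strictness.\<close>
    then have "(\<Sum>j<n. 0 * c j) \<le> G (x 0 - 1)"
    proof (rule tendsto_upperbound)
      show "\<forall>\<^sub>F s in at_bot. G s \<le> G (x 0 - 1)"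
        using eventually_le_at_bot[of "x 0 - 1"]
      proof eventually_elim
        case (elim s)
        then show ?case using inc[of s "x 0 - 1"] by (cases "s = x 0 - 1") auto
      qed
    qed auto
    moreover have "G (x 0 - 1) < G (x 0)" by (rule inc) auto
    moreover have "G (x 0) = ndet n (\<lambda>i j. if i < 1 then h j (x i) else h' j (x i))"
      unfolding G_def by (rule ndet_cong) (auto simp: R_def)
    ultimately show "0 < ndet n (\<lambda>i j. if i < 1 then h j (x i) else h' j (x i))" by simp
  qed (use x in auto)
qed simp

text \<open>Taking \<open>exp (x i * y 0)\<close> out of each row makes column 0 constant.
  Differentiating all rows but the first leaves only the corner in that column, and the rest is, up
  to positive factors, a smaller minor of the same kind.\<close>

lemma ndet_exp_pos:
  assumes "strict_mono_on {..<n} x" "strict_mono_on {..<n} y"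
  shows "0 < ndet n (\<lambda>i j. exp (x i * y j))"
  using assms
proof (induction n arbitrary: x y)
  case (Suc n)
  define z where "z j = y j - y 0" for j
  have z: "0 < z (Suc j)" if "j < n" for j
    using Suc.prems that by (auto simp: z_def strict_mono_on_def)
  have "0 < ndet (Suc n) (\<lambda>i j. exp (x i * z j))"
  proof (rule ndet_antiderivative_rows_from[where h = "\<lambda>j s. exp (s * z j)" and m = 1
        and h' = "\<lambda>j s. z j * exp (s * z j)"])
    fix x :: "nat \<Rightarrow> real" assume x: "strict_mono_on {..<Suc n} x"
    define a where "a = (\<lambda>i j. if i < 1 then exp (x i * z j) else z j * exp (x i * z j))"
    have "ndet (Suc n) a = a 0 0 * ndet n (\<lambda>i j. a (Suc i) (Suc j))"
      by (rule ndet_corner) (auto simp: a_def z_def)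
    also have "ndet n (\<lambda>i j. a (Suc i) (Suc j)) = ndet n (\<lambda>i j.
        exp (- (x (Suc i) * y 0)) * z (Suc j) * exp (x (Suc i) * y (Suc j)))"
      by (rule ndet_cong) (auto simp: a_def z_def algebra_simps simp flip: exp_add)
    also have "\<dots> = (\<Prod>i<n. exp (- (x (Suc i) * y 0))) * (\<Prod>j<n. z (Suc j))
        * ndet n (\<lambda>i j. exp (x (Suc i) * y (Suc j)))"
      by (rule ndet_scale)
    also have "a 0 0 * \<dots> > 0"
      using x Suc.prems(2)
      by (intro mult_pos_pos prod_pos Suc.IH) (auto simp: a_def z strict_mono_on_def)
    finally show "0 < ndet (Suc n) a" .
  qed (use Suc.prems in \<open>auto intro!: derivative_eq_intros\<close>)
  moreover have "ndet (Suc n) (\<lambda>i j. exp (x i * y j)) =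
      ndet (Suc n) (\<lambda>i j. exp (x i * y 0) * 1 * exp (x i * z j))"
    by (rule ndet_cong) (auto simp: z_def algebra_simps simp flip: exp_add)
  ultimately show ?case
    by (simp only: ndet_scale) (intro mult_pos_pos prod_pos, auto)
qed simp

section \<open>Totally positive convolution kernels\<close>

abbreviation tp :: "(real \<Rightarrow> real) \<Rightarrow> bool" where
  "tp f \<equiv> totally_positive_kernel (toeplitz_kernel f)"

abbreviation tn :: "(real \<Rightarrow> real) \<Rightarrow> bool" where
  "tn f \<equiv> totally_nonneg_kernel (toeplitz_kernel f)"

lemma tpI:
  assumes "\<And>n x y. strict_mono_on {..<n} x \<Longrightarrow> strict_mono_on {..<n} y \<Longrightarrow>
    0 < ndet n (\<lambda>i j. f (x i - y j))"
  shows "tp f"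
  using assms by (simp add: totally_positive_kernel_def toeplitz_kernel_def det_kernel_matrix)

lemma tpD:
  assumes "tp f" "strict_mono_on {..<n} x" "strict_mono_on {..<n} y"
  shows "0 < ndet n (\<lambda>i j. f (x i - y j))"
  using assms by (cases "n = 0")
    (auto simp: totally_positive_kernel_def toeplitz_kernel_def det_kernel_matrix)

lemma tnI:
  assumes "\<And>n x y. strict_mono_on {..<n} x \<Longrightarrow> strict_mono_on {..<n} y \<Longrightarrow>
    0 \<le> ndet n (\<lambda>i j. f (x i - y j))"
  shows "tn f"
  using assms by (simp add: totally_nonneg_kernel_def toeplitz_kernel_def det_kernel_matrix)

lemma tnD:
  assumes "tn f" "strict_mono_on {..<n} x" "strict_mono_on {..<n} y"
  shows "0 \<le> ndet n (\<lambda>i j. f (x i - y j))"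
  using assms by (cases "n = 0")
    (auto simp: totally_nonneg_kernel_def toeplitz_kernel_def det_kernel_matrix)

lemma tp_imp_tn: "tp f \<Longrightarrow> tn f"
  by (rule tnI) (use tpD less_imp_le in blast)

lemma tp_pos:
  assumes "tp f"
  shows "0 < f x"
proof -
  have "strict_mono_on {..<Suc 0} z" for z :: "nat \<Rightarrow> real" by (auto simp: strict_mono_on_def)
  from tpD[OF assms this this, of "\<lambda>_. x" "\<lambda>_. 0"] show ?thesis by (simp add: ndet_1)
qed

lemma tp_exp_mult:
  assumes "tp f" "0 < c"
  shows "tp (\<lambda>x. c * exp (b * x) * f x)"
proof (rule tpI)
  fix n and x y :: "nat \<Rightarrow> real"
  assume xy: "strict_mono_on {..<n} x" "strict_mono_on {..<n} y"
  have "ndet n (\<lambda>i j. c * exp (b * (x i - y j)) * f (x i - y j)) =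
      ndet n (\<lambda>i j. (c * exp (b * x i)) * exp (- (b * y j)) * f (x i - y j))"
    by (rule ndet_cong) (auto simp: algebra_simps simp flip: exp_add)
  also have "\<dots> > 0"
    unfolding ndet_scale by (intro mult_pos_pos prod_pos tpD xy assms) (simp_all add: assms)
  finally show "0 < ndet n (\<lambda>i j. c * exp (b * (x i - y j)) * f (x i - y j))" .
qed

lemma tp_dilate:
  assumes "tp f" "0 < q"
  shows "tp (\<lambda>x. f (q * x))"
proof (rule tpI)
  fix n and x y :: "nat \<Rightarrow> real"
  assume "strict_mono_on {..<n} x" "strict_mono_on {..<n} y"
  then have "0 < ndet n (\<lambda>i j. f (q * x i - q * y j))"
    using assms by (intro tpD) (auto simp: strict_mono_on_def)
  then show "0 < ndet n (\<lambda>i j. f (q * (x i - y j)))"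
    by (simp add: right_diff_distrib)
qed

lemma tn_mult:
  assumes "tn f" "0 < c"
  shows "tn (\<lambda>x. c * f x)"
proof (rule tnI)
  fix n and x y :: "nat \<Rightarrow> real"
  assume xy: "strict_mono_on {..<n} x" "strict_mono_on {..<n} y"
  have "ndet n (\<lambda>i j. c * f (x i - y j)) = ndet n (\<lambda>i j. c * 1 * f (x i - y j))"
    by simp
  also have "\<dots> \<ge> 0"
    unfolding ndet_scale by (intro mult_nonneg_nonneg prod_nonneg tnD xy assms) (use assms in auto)
  finally show "0 \<le> ndet n (\<lambda>i j. c * f (x i - y j))" .
qed

lemma tn_limit:
  assumes "eventually (\<lambda>t. tn (f t)) F" "F \<noteq> bot" "\<And>x. ((\<lambda>t. f t x) \<longlongrightarrow> g x) F"
  shows "tn g"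
proof (rule tnI)
  fix n and x y :: "nat \<Rightarrow> real"
  assume xy: "strict_mono_on {..<n} x" "strict_mono_on {..<n} y"
  show "0 \<le> ndet n (\<lambda>i j. g (x i - y j))"
  proof (rule tendsto_lowerbound)
    show "((\<lambda>t. ndet n (\<lambda>i j. f t (x i - y j))) \<longlongrightarrow> ndet n (\<lambda>i j. g (x i - y j))) F"
      by (intro tendsto_ndet assms)
    show "\<forall>\<^sub>F t in F. 0 \<le> ndet n (\<lambda>i j. f t (x i - y j))"
      using assms(1) by eventually_elim (intro tnD xy)
  qed (use assms in auto)
qed

text \<open>The kernel is \<open>exp (u * v)\<close> with \<open>u = exp x\<close> and
  \<open>v = - exp (- y)\<close>, both increasing.\<close>

lemma tp_gumbel: "tp (\<lambda>x. exp (- exp x))"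
proof (rule tpI)
  fix n and x y :: "nat \<Rightarrow> real"
  assume "strict_mono_on {..<n} x" "strict_mono_on {..<n} y"
  then have "0 < ndet n (\<lambda>i j. exp (exp (x i) * (- exp (- y j))))"
    by (intro ndet_exp_pos) (auto simp: strict_mono_on_def)
  then show "0 < ndet n (\<lambda>i j. exp (- exp (x i - y j)))"
    by (simp flip: exp_add)
qed

text \<open>Expanding the square splits off row and column factors and leaves
  \<open>exp (x * (2 * y))\<close>.\<close>

lemma tp_gauss: "tp (\<lambda>x. exp (- x\<^sup>2))"
proof (rule tpI)
  fix n and x y :: "nat \<Rightarrow> real"
  assume xy: "strict_mono_on {..<n} x" "strict_mono_on {..<n} y"
  have "ndet n (\<lambda>i j. exp (- (x i - y j)\<^sup>2)) =
      ndet n (\<lambda>i j. exp (- (x i)\<^sup>2) * exp (- (y j)\<^sup>2) * exp (x i * (2 * y j)))"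
    by (rule ndet_cong) (simp add: power2_eq_square algebra_simps flip: exp_add)
  also have "\<dots> > 0"
    unfolding ndet_scale
    by (intro mult_pos_pos prod_pos ndet_exp_pos) (use xy in \<open>auto simp: strict_mono_on_def\<close>)
  finally show "0 < ndet n (\<lambda>i j. exp (- (x i - y j)\<^sup>2))" .
qed

text \<open>The hypotheses say that \<open>g\<close> is the convolution of \<open>f\<close> with the one-sided exponential
  \<open>exp (- a x)\<close>.\<close>

lemma tp_convolve_exp:
  assumes f: "tp f"
    and der: "\<And>x. (g has_real_derivative f x - a * g x) (at x)"
    and lim: "((\<lambda>x. exp (a * x) * g x) \<longlongrightarrow> 0) at_bot"
  shows "tp g"
proof (rule tpI)
  fix n and x y :: "nat \<Rightarrow> real"
  assume xy: "strict_mono_on {..<n} x" "strict_mono_on {..<n} y"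
  \<comment> \<open>Integrating factor: the derivative of \<open>exp (a * s) * g (s - y j)\<close>
    is \<open>exp (a * s) * f (s - y j)\<close>.\<close>
  have "0 < ndet n (\<lambda>i j. exp (a * x i) * g (x i - y j))"
  proof (rule ndet_antiderivative_rows[where h = "\<lambda>j s. exp (a * s) * g (s - y j)"
        and h' = "\<lambda>j s. exp (a * s) * f (s - y j)"])
    fix j s
    show "((\<lambda>s. exp (a * s) * g (s - y j)) has_real_derivative exp (a * s) * f (s - y j)) (at s)"
      by (auto intro!: derivative_eq_intros DERIV_chain2[of g _ "\<lambda>s. s - y j"] der simp: algebra_simps)
    have "((\<lambda>s. exp (a * y j) * (exp (a * (s - y j)) * g (s - y j))) \<longlongrightarrow> exp (a * y j) * 0) at_bot"
      by (intro tendsto_intros filterlim_compose[OF lim, of "\<lambda>s. s - y j"]) real_asymp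
    then show "((\<lambda>s. exp (a * s) * g (s - y j)) \<longlongrightarrow> 0) at_bot"
      by (simp add: right_diff_distrib flip: mult.assoc exp_add)
  next
    fix x :: "nat \<Rightarrow> real" assume x: "strict_mono_on {..<n} x"
    have "0 < (\<Prod>i<n. exp (a * x i)) * (\<Prod>j<n. 1) * ndet n (\<lambda>i j. f (x i - y j))"
      by (intro mult_pos_pos prod_pos tpD f x xy) auto
    also have "\<dots> = ndet n (\<lambda>i j. exp (a * x i) * 1 * f (x i - y j))"
      by (rule ndet_scale[symmetric])
    finally show "0 < ndet n (\<lambda>i j. exp (a * x i) * f (x i - y j))" by simp
  qed (rule xy)
  also have "\<dots> = ndet n (\<lambda>i j. exp (a * x i) * 1 * g (x i - y j))"
    by simp
  also have "\<dots> = (\<Prod>i<n. exp (a * x i)) * ndet n (\<lambda>i j. g (x i - y j))"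
    unfolding ndet_scale by simp
  finally have "0 < (\<Prod>i<n. exp (a * x i)) * ndet n (\<lambda>i j. g (x i - y j))" .
  moreover have "0 < (\<Prod>i<n. exp (a * x i))" by (simp add: prod_pos)
  ultimately show "0 < ndet n (\<lambda>i j. g (x i - y j))" by (rule zero_less_mult_pos)
qed

section \<open>Integrability by exponential decay, and the explicit test functions\<close>

lemma integrable_lborel_exp_abs:
  assumes "0 < (a::real)"
  shows "integrable lborel (\<lambda>x. exp (- a * \<bar>x\<bar>))"
proof -
  define e where "e x = indicator {0..} x *\<^sub>R exp (- a * x)" for x :: real
  have "(\<lambda>x. exp (- a * x)) absolutely_integrable_on {0..}"
    using assms by (intro nonnegative_absolutely_integrable_1 integrable_on_exp_minus_to_infinity) auto
  then have "integrable lebesgue e"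
    by (simp add: e_def[abs_def] set_integrable_def)
  then have e: "integrable lborel e"
    by (subst (asm) integrable_completion) (auto simp: e_def[abs_def])
  then have "integrable lborel (\<lambda>x. e (0 + (- 1) * x))"
    by (rule lborel_integrable_real_affine) simp
  with e have "integrable lborel (\<lambda>x. e x + e (- x))"
    by simp
  then show ?thesis
    by (rule Bochner_Integration.integrable_bound) (auto simp: e_def indicator_def)
qed

text \<open>\<open>exp (a * \<bar>x\<bar>) * f x\<close> is bounded: on the tails by the two limits,
  in between by continuity on a compact interval.\<close>

lemma integrable_exponential_decay:
  fixes f :: "real \<Rightarrow> real"
  assumes "0 < a" "continuous_on UNIV f"
    and "((\<lambda>x. exp (a * x) * f x) \<longlongrightarrow> 0) at_top" "((\<lambda>x. exp (- a * x) * f x) \<longlongrightarrow> 0) at_bot"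
  shows "integrable lebesgue f"
proof -
  have "eventually (\<lambda>x. \<bar>exp (a * x) * f x\<bar> < 1 \<and> 0 \<le> x) at_top"
    using eventually_conj[OF tendstoD[OF assms(3), of 1] eventually_ge_at_top[of 0]] by simp
  then obtain N where N: "\<And>x. N \<le> x \<Longrightarrow> \<bar>exp (a * x) * f x\<bar> < 1 \<and> 0 \<le> x"
    by (auto simp: eventually_at_top_linorder)
  have "eventually (\<lambda>x. \<bar>exp (- a * x) * f x\<bar> < 1 \<and> x \<le> 0) at_bot"
    using eventually_conj[OF tendstoD[OF assms(4), of 1] eventually_le_at_bot[of 0]] by simp
  then obtain M where M: "\<And>x. x \<le> M \<Longrightarrow> \<bar>exp (- a * x) * f x\<bar> < 1 \<and> x \<le> 0"
    by (auto simp: eventually_at_bot_linorder)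
  have "continuous_on {M..N} (\<lambda>x. exp (a * \<bar>x\<bar>) * f x)"
    by (intro continuous_intros continuous_on_subset[OF assms(2)]) auto
  then have "bounded ((\<lambda>x. exp (a * \<bar>x\<bar>) * f x) ` {M..N})"
    by (intro compact_imp_bounded compact_continuous_image) auto
  then obtain B where B: "\<forall>x\<in>{M..N}. \<bar>exp (a * \<bar>x\<bar>) * f x\<bar> \<le> B"
    by (auto simp: bounded_iff)
  have le: "\<bar>exp (a * \<bar>x\<bar>) * f x\<bar> \<le> max 1 B" for x
    using N[of x] M[of x] bspec[OF B, of x] by (cases "x \<le> M"; cases "N \<le> x") auto
  have f: "f \<in> borel_measurable borel"
    by (rule borel_measurable_continuous_onI[OF assms(2)])
  have "integrable lborel (\<lambda>x. max 1 B * exp (- a * \<bar>x\<bar>))"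
    using integrable_lborel_exp_abs[OF assms(1)] by simp
  then have "integrable lborel f"
  proof (rule Bochner_Integration.integrable_bound)
    show "f \<in> borel_measurable lborel"
      using f by simp
    have "norm (f x) \<le> norm (max 1 B * exp (- a * \<bar>x\<bar>))" for x
    proof -
      have "exp (a * \<bar>x\<bar>) * \<bar>f x\<bar> \<le> max 1 B" using le[of x] by (simp add: abs_mult)
      then have "\<bar>f x\<bar> \<le> max 1 B / exp (a * \<bar>x\<bar>)" by (simp add: pos_le_divide_eq mult.commute)
      then show ?thesis by (simp add: exp_minus divide_inverse)
    qed
    then show "AE x in lborel. norm (f x) \<le> norm (max 1 B * exp (- a * \<bar>x\<bar>))" by simp
  qed
  then show ?thesis by (subst integrable_completion) (use f in auto)
qed

lemma tppfI:
  assumes "tp f" "integrable lebesgue f"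
  shows "totally_positive_polya_frequency f"
proof -
  have "f 0 \<noteq> 0" "f 1 \<noteq> 0" using tp_pos[OF assms(1), of 0] tp_pos[OF assms(1), of 1] by auto
  then show ?thesis
    using assms tp_imp_tn tp_pos[OF assms(1)]
    unfolding totally_positive_polya_frequency_def polya_frequency_def
    by (metis less_imp_le zero_neq_one)
qed

lemma tppf_gauss:
  assumes "0 < c"
  shows "totally_positive_polya_frequency (\<lambda>x. c * exp (- x\<^sup>2))"
proof (rule tppfI)
  show "tp (\<lambda>x. c * exp (- x\<^sup>2))"
    using tp_exp_mult[OF tp_gauss assms, of 0] by simp
  show "integrable lebesgue (\<lambda>x. c * exp (- x\<^sup>2))"
  proof (rule integrable_exponential_decay[of 1])
    show "((\<lambda>x. exp (1 * x) * (c * exp (- x\<^sup>2))) \<longlongrightarrow> 0) at_top" by real_asymp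
    show "((\<lambda>x. exp (- 1 * x) * (c * exp (- x\<^sup>2))) \<longlongrightarrow> 0) at_bot" by real_asymp
  qed (auto intro!: continuous_intros)
qed

text \<open>\<open>1 - exp (- exp x)\<close> is the antiderivative of
  \<open>exp x * exp (- exp x)\<close> vanishing at minus infinity, a convolution with rate 0.
  Dilation and an exponential factor keep total positivity; \<open>1 < q\<close> gives decay at
  minus infinity.\<close>

lemma tppf_smoothed_exp:
  assumes "0 < c" "1 < q"
  shows "totally_positive_polya_frequency (\<lambda>x. c * exp (- x) * (1 - exp (- exp (q * x))))"
proof (rule tppfI)
  have "tp (\<lambda>x. 1 - exp (- exp x))"
  proof (rule tp_convolve_exp[where a = 0])
    show "tp (\<lambda>x. 1 * exp (1 * x) * exp (- exp x))" by (rule tp_exp_mult[OF tp_gumbel]) simp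
    have "((\<lambda>x::real. 1 - exp (- exp x)) \<longlongrightarrow> 0) at_bot" by real_asymp
    then show "((\<lambda>x::real. exp (0 * x) * (1 - exp (- exp x))) \<longlongrightarrow> 0) at_bot" by simp
  qed (auto intro!: derivative_eq_intros)
  then have "tp (\<lambda>x. 1 - exp (- exp (q * x)))"
    using assms by (intro tp_dilate[where f = "\<lambda>x. 1 - exp (- exp x)"]) auto
  from tp_exp_mult[OF this assms(1), of "-1"]
  show "tp (\<lambda>x. c * exp (- x) * (1 - exp (- exp (q * x))))" by simp
  \<comment> \<open>\<open>a\<close> is the decay rate claimed at both ends. At minus infinity,
    bounding \<open>1 - exp (- t)\<close> by \<open>t\<close> leaves a multiple of
    \<open>exp (b * x)\<close>.\<close>
  obtain a b where a: "0 < a" "a < 1" "0 < b" and q: "q = 1 + a + b"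
  proof
    show "0 < min (1/2) ((q - 1) / 2)" "min (1/2) ((q - 1) / 2) < 1"
        "0 < q - 1 - min (1/2) ((q - 1) / 2)"
      using assms by (auto simp: min_def)
  qed simp
  show "integrable lebesgue (\<lambda>x. c * exp (- x) * (1 - exp (- exp (q * x))))"
  proof (rule integrable_exponential_decay[OF a(1)])
    show "((\<lambda>x. exp (a * x) * (c * exp (- x) * (1 - exp (- exp (q * x))))) \<longlongrightarrow> 0) at_top"
      unfolding q using a assms(1) by real_asymp
    have "norm (exp (- a * x) * (c * exp (- x) * (1 - exp (- exp (q * x))))) \<le> c * exp (b * x)" for x
    proof -
      have "exp (- a * x) * (c * exp (- x) * (1 - exp (- exp (q * x))))
          \<le> exp (- a * x) * (c * exp (- x) * exp (q * x))"
        using assms(1) exp_ge_add_one_self[of "- exp (q * x)"] by (intro mult_left_mono) auto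
      also have "\<dots> = c * exp (b * x)"
        by (simp add: q algebra_simps flip: exp_add)
      finally show ?thesis using assms(1) by (simp add: abs_mult)
    qed
    moreover have "((\<lambda>x. c * exp (b * x)) \<longlongrightarrow> 0) at_bot"
      using a by real_asymp
    ultimately show "((\<lambda>x. exp (- a * x) * (c * exp (- x) * (1 - exp (- exp (q * x))))) \<longlongrightarrow> 0) at_bot"
      by (rule Lim_null_comparison[OF always_eventually[OF allI]])
  qed (intro continuous_intros)
qed

lemma DERIV_exp_mult:
  assumes "(A has_real_derivative exp (a * x) * B) (at x)"
  shows "((\<lambda>x. exp (- a * x) * A x) has_real_derivative B - a * (exp (- a * x) * A x)) (at x)"
  by (auto intro!: derivative_eq_intros assms simp: algebra_simps simp flip: exp_add)

text \<open>Up to the factor \<open>exp (x / 2)\<close>, this is the convolution of \<open>exp (- exp x)\<close> with the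
  one-sided exponentials of rates 1, 3 and 6.  The coefficients 1/10, -1/6, 1/15 are those of the
  partial fraction expansion of \<open>1 / ((s + 1) (s + 3) (s + 6))\<close>, and the polynomials are those of
  the incomplete gamma functions \<open>\<gamma>(k, exp x)\<close>, \<open>k = 1, 3, 6\<close>.\<close>

definition hypoexp :: "real \<Rightarrow> real" where
  "hypoexp x = exp (x / 2) *
     (exp (- 1 * x) * (1 - exp (- exp x)) / 10
      - exp (- 3 * x) * (2 - exp (- exp x) * (2 + 2 * exp x + exp x ^ 2)) / 6
      + exp (- 6 * x) * (120 - exp (- exp x) * (120 + 120 * exp x + 60 * exp x ^ 2
           + 20 * exp x ^ 3 + 5 * exp x ^ 4 + exp x ^ 5)) / 15)"

text \<open>Convolving \<open>T6\<close> with rate 3 gives \<open>(T3 - T6) / 3\<close>, and then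
  rate 1 gives the combination in \<open>hypoexp\<close>. That combination tends to 1/18 at minus
  infinity, where the factor \<open>exp (x / 2)\<close> supplies the decay.\<close>

lemma tppf_hypoexp: "totally_positive_polya_frequency hypoexp"
proof (rule tppfI)
  define T1 where "T1 x = exp (- 1 * x) * (1 - exp (- exp x))" for x :: real
  define T3 where "T3 x = exp (- 3 * x) * (2 - exp (- exp x) * (2 + 2 * exp x + exp x ^ 2))" for x :: real
  define T6 where "T6 x = exp (- 6 * x) * (120 - exp (- exp x) * (120 + 120 * exp x + 60 * exp x ^ 2
           + 20 * exp x ^ 3 + 5 * exp x ^ 4 + exp x ^ 5))" for x :: real
  have T1: "(T1 has_real_derivative exp (- exp x) - 1 * T1 x) (at x)" for x
    unfolding T1_def by (rule DERIV_exp_mult) (auto intro!: derivative_eq_intros)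
  have e: "exp (3 * x) = exp x ^ 3" "exp (6 * x) = exp x ^ 6" for x :: real
    using exp_of_nat_mult[of 3 x] exp_of_nat_mult[of 6 x] by simp_all
  have T3: "(T3 has_real_derivative exp (- exp x) - 3 * T3 x) (at x)" for x
    unfolding T3_def
    by (rule DERIV_exp_mult, unfold e) (auto intro!: derivative_eq_intros simp: eval_nat_numeral algebra_simps)
  have T6: "(T6 has_real_derivative exp (- exp x) - 6 * T6 x) (at x)" for x
    unfolding T6_def
    by (rule DERIV_exp_mult, unfold e) (auto intro!: derivative_eq_intros simp: eval_nat_numeral algebra_simps)
  have "tp T6"
  proof (rule tp_convolve_exp[OF tp_gumbel T6])
    show "((\<lambda>x. exp (6 * x) * T6 x) \<longlongrightarrow> 0) at_bot" unfolding T6_def by real_asymp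
  qed
  then have "tp (\<lambda>x. (T3 x - T6 x) / 3)"
  proof (rule tp_convolve_exp)
    show "((\<lambda>x. (T3 x - T6 x) / 3) has_real_derivative T6 x - 3 * ((T3 x - T6 x) / 3)) (at x)" for x
      by (rule DERIV_cong[OF DERIV_cdivide[OF DERIV_diff[OF T3 T6]]]) (simp add: field_simps)
    show "((\<lambda>x. exp (3 * x) * ((T3 x - T6 x) / 3)) \<longlongrightarrow> 0) at_bot"
      unfolding T3_def T6_def by real_asymp
  qed
  then have "tp (\<lambda>x. T1 x / 10 - T3 x / 6 + T6 x / 15)"
  proof (rule tp_convolve_exp)
    show "((\<lambda>x. T1 x / 10 - T3 x / 6 + T6 x / 15) has_real_derivative
        (T3 x - T6 x) / 3 - 1 * (T1 x / 10 - T3 x / 6 + T6 x / 15)) (at x)" for x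
      by (rule DERIV_cong[OF DERIV_add[OF DERIV_diff[OF DERIV_cdivide[OF T1] DERIV_cdivide[OF T3]]
              DERIV_cdivide[OF T6]]]) (simp add: field_simps)
    show "((\<lambda>x. exp (1 * x) * (T1 x / 10 - T3 x / 6 + T6 x / 15)) \<longlongrightarrow> 0) at_bot"
      unfolding T1_def T3_def T6_def by real_asymp
  qed
  from tp_exp_mult[OF this, of 1 "1/2"] show "tp hypoexp"
    by (simp add: hypoexp_def[abs_def] T1_def T3_def T6_def)
  show "integrable lebesgue hypoexp"
  proof (rule integrable_exponential_decay[of "1/4"])
    show "continuous_on UNIV hypoexp"
    proof -
      have "continuous_on UNIV T1" "continuous_on UNIV T3" "continuous_on UNIV T6"
        by (meson T1 T3 T6 DERIV_isCont continuous_at_imp_continuous_on)+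
      then have "continuous_on UNIV (\<lambda>x. exp (x / 2) * (T1 x / 10 - T3 x / 6 + T6 x / 15))"
        by (intro continuous_on_mult continuous_on_add continuous_on_diff continuous_on_exp
            continuous_on_divide continuous_on_id continuous_on_const) auto
      then show ?thesis by (simp add: hypoexp_def[abs_def] T1_def T3_def T6_def)
    qed
    show "((\<lambda>x. exp (1/4 * x) * hypoexp x) \<longlongrightarrow> 0) at_top" unfolding hypoexp_def by real_asymp
    show "((\<lambda>x. exp (- (1/4) * x) * hypoexp x) \<longlongrightarrow> 0) at_bot" unfolding hypoexp_def by real_asymp
  qed simp
qed

section \<open>Minors at infinity\<close>

lemma ndet_diagonal: "ndet n (\<lambda>i j. if i = j then p i else 0) = (\<Prod>i<n. p i)"
proof (induction n arbitrary: p)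
  case (Suc n)
  have "ndet (Suc n) (\<lambda>i j. if i = j then p i else 0) = p 0 * ndet n (\<lambda>i j. if i = j then p (Suc i) else 0)"
    by (subst ndet_corner) auto
  then show ?case by (simp only: Suc.IH prod.lessThan_Suc_shift o_def)
qed simp

lemma ndet_reverse_rows:
  obtains \<sigma> where "\<sigma> \<noteq> 0" "\<And>a. ndet n (\<lambda>i. a (n - 1 - i)) = \<sigma> * ndet n a"
proof -
  define \<rho> where "\<rho> i = (if i < n then n - 1 - i else i)" for i
  have "\<rho> permutes {0..<n}"
    by (intro bij_imp_permutes bij_betw_byWitness[where f' = \<rho>]) (auto simp: \<rho>_def)
  then have "ndet n (\<lambda>i. a (n - 1 - i)) = signof \<rho> * ndet n a" for a
  proof -
    have "Determinant.det (Matrix.mat n n (\<lambda>(i, j). Matrix.mat n n (\<lambda>(i, j). a i j) $$ (\<rho> i, j))) =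
        signof \<rho> * ndet n a"
      unfolding ndet_def by (rule det_permute_rows) (use \<open>\<rho> permutes _\<close> in auto)
    also have "Matrix.mat n n (\<lambda>(i, j). Matrix.mat n n (\<lambda>(i, j). a i j) $$ (\<rho> i, j)) =
        Matrix.mat n n (\<lambda>(i, j). a (n - 1 - i) j)"
      by (rule eq_matI) (auto simp: \<rho>_def)
    finally show ?thesis by (simp add: ndet_def)
  qed
  then show thesis by (intro that[of "of_int (sign \<rho>)"]) (auto simp: sign_def)
qed

lemma ndet_nonzero_inverse:
  assumes "ndet n a \<noteq> 0"
  obtains B where "B \<in> carrier_mat n n" "Matrix.mat n n (\<lambda>(i, j). a i j) * B = 1\<^sub>m n"
    "B * Matrix.mat n n (\<lambda>(i, j). a i j) = 1\<^sub>m n"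
proof -
  have "Matrix.mat n n (\<lambda>(i, j). a i j) \<in> Units (ring_mat TYPE(real) n ())"
    by (rule det_non_zero_imp_unit) (use assms in \<open>auto simp: ndet_def\<close>)
  then show thesis using that by (auto simp: Units_def ring_mat_def)
qed

lemma index_mult_mat_sum:
  assumes "A \<in> carrier_mat n n" "B \<in> carrier_mat n n" "i < n" "j < n"
  shows "(A * B) $$ (i, j) = (\<Sum>k<n. A $$ (i, k) * B $$ (k, j))"
  using assms by (auto simp: scalar_prod_def atLeast0LessThan)

text \<open>With \<open>M i j = f (T + i - j)\<close>, the expansion reads \<open>M = A (D + A\<inverse> R C\<inverse>) C\<close>
  where \<open>A\<close> and \<open>C\<close> are generalized Vandermonde matrices independent of \<open>T\<close>, \<open>D\<close> is diagonal
  and \<open>R\<close> holds the remainders.  Multiplying row \<open>k\<close> of the middle factor by \<open>exp (\<mu> k T)\<close>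
  makes it converge to the diagonal matrix of the coefficients.\<close>

lemma tn_expansion_sign:
  assumes f: "tn f"
    and mu: "strict_mono_on {..<n} \<mu>" "\<And>k. k < n \<Longrightarrow> \<mu> k \<le> \<nu>"
    and lim: "((\<lambda>x. (f x - (\<Sum>k<n. p k * exp (- \<mu> k * x))) * exp (\<nu> * x)) \<longlongrightarrow> 0) at_top"
  shows "0 \<le> ndet n (\<lambda>i k. exp (- (real i * \<mu> k))) * (\<Prod>k<n. p k)"
proof -
  define r where "r x = f x - (\<Sum>k<n. p k * exp (- \<mu> k * x))" for x
  define a where "a = (\<lambda>i k. exp (- (real i * \<mu> k)))"
  define c where "c = (\<lambda>k j. exp (\<mu> k * real j))"
  define A where "A = Matrix.mat n n (\<lambda>(i, k). a i k)"
  define C where "C = Matrix.mat n n (\<lambda>(k, j). c k j)"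
  define D where "D T = Matrix.mat n n (\<lambda>(k, l). if k = l then p k * exp (- \<mu> k * T) else 0)" for T
  define R where "R T = Matrix.mat n n (\<lambda>(i, j). r (T + real i - real j))" for T
  have [simp]: "A \<in> carrier_mat n n" "C \<in> carrier_mat n n" "D T \<in> carrier_mat n n"
    "R T \<in> carrier_mat n n" for T
    by (simp_all add: A_def C_def D_def R_def)
  have detC: "0 < ndet n c"
    unfolding c_def by (rule ndet_exp_pos) (use mu in \<open>auto simp: strict_mono_on_def\<close>)
  \<comment> \<open>The row nodes \<open>- i\<close> of \<open>a\<close> decrease; reversing the
    rows makes \<open>ndet_exp_pos\<close> applicable, so \<open>a\<close> is non-singular.\<close>
  have "0 < ndet n (\<lambda>i k. exp ((- real (n - 1 - i)) * \<mu> k))"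
    by (rule ndet_exp_pos) (use mu in \<open>auto simp: strict_mono_on_def\<close>)
  also have "\<dots> = ndet n (\<lambda>i. a (n - 1 - i))"
    by (rule ndet_cong) (auto simp: a_def of_nat_diff algebra_simps)
  finally have detA: "ndet n a \<noteq> 0"
    using ndet_reverse_rows[of n] by (metis less_irrefl mult_zero_right)
  obtain A' where A': "A' \<in> carrier_mat n n" "A * A' = 1\<^sub>m n"
    using ndet_nonzero_inverse[OF detA] unfolding A_def by blast
  obtain C' where C': "C' \<in> carrier_mat n n" "C' * C = 1\<^sub>m n"
    using ndet_nonzero_inverse[of n c] detC unfolding C_def by auto
  define G where "G T = D T + A' * R T * C'" for T
  note [simp] = A'(1) C'(1)
  have X [simp]: "A' * R T * C' \<in> carrier_mat n n" for T
    by (intro mult_carrier_mat[of _ n n]) auto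
  have [simp]: "G T \<in> carrier_mat n n" for T
    unfolding G_def by (rule add_carrier_mat[OF X])
  have M: "Matrix.mat n n (\<lambda>(i, j). f (T + real i - real j)) = A * G T * C" for T
  proof -
    have "A * (A' * R T * C') * C = A * (A' * R T) * C' * C"
      by (simp add: assoc_mult_mat[of A n n "A' * R T" n C' n] mult_carrier_mat[of _ n n])
    also have "\<dots> = A * (A' * R T) * (C' * C)"
      by (rule assoc_mult_mat[of _ n n _ n _ n]) (auto intro!: mult_carrier_mat[of _ n n])
    also have "\<dots> = R T"
      by (simp add: A' C' left_mult_one_mat[of _ n n] right_mult_one_mat[of _ n n]
          flip: assoc_mult_mat[of A n n A' n "R T" n])
    finally have X': "A * (A' * R T * C') * C = R T" .
    have "A * G T * C = (A * D T + A * (A' * R T * C')) * C"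
      unfolding G_def by (simp add: mult_add_distrib_mat[of A n n "D T" n])
    also have "\<dots> = A * D T * C + A * (A' * R T * C') * C"
      by (rule add_mult_distrib_mat[of _ n n _ _ n]) (auto intro!: mult_carrier_mat[of _ n n])
    also note X'
    finally have "A * G T * C = A * D T * C + R T" .
    moreover have "Matrix.mat n n (\<lambda>(i, j). f (T + real i - real j)) = A * D T * C + R T"
    proof (rule eq_matI)
      fix i j assume "i < dim_row (A * D T * C + R T)" "j < dim_col (A * D T * C + R T)"
      then have ij: "i < n" "j < n" by (simp_all add: C_def R_def)
      have "(A * D T * C) $$ (i, j) = (\<Sum>k<n. (\<Sum>l<n. a i l * (if l = k then p l * exp (- \<mu> l * T) else 0)) * c k j)"
        using ij by (simp add: A_def D_def C_def scalar_prod_def atLeast0LessThan)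
      also have "\<dots> = (\<Sum>k<n. a i k * (p k * exp (- \<mu> k * T)) * c k j)"
        by (simp add: if_distrib[of "(*) _"] sum.delta cong: if_cong)
      also have "\<dots> = (\<Sum>k<n. p k * exp (- \<mu> k * (T + real i - real j)))"
        by (intro sum.cong) (auto simp: a_def c_def algebra_simps simp flip: exp_add)
      finally show "Matrix.mat n n (\<lambda>(i, j). f (T + real i - real j)) $$ (i, j) = (A * D T * C + R T) $$ (i, j)"
        using ij by (simp add: R_def r_def C_def A_def)
    qed (simp_all add: C_def R_def)
    ultimately show ?thesis by simp
  qed
  define g where "g T k l = G T $$ (k, l)" for T k l
  have det: "0 \<le> ndet n a * ndet n (g T) * ndet n c" for T
  proof -
    have "0 \<le> ndet n (\<lambda>i j. f ((T + real i) - real j))"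
      by (rule tnD[OF f]) (auto simp: strict_mono_on_def)
    also have "\<dots> = Determinant.det (A * G T * C)"
      by (simp add: ndet_def M)
    also have "\<dots> = Determinant.det A * Determinant.det (G T) * Determinant.det C"
      by (simp add: det_mult[of "A * G T" n C] det_mult[of A n "G T"] mult_carrier_mat[of A n n "G T" n])
    also have "Determinant.det (G T) = ndet n (g T)"
      unfolding ndet_def g_def
      by (rule arg_cong[where f = Determinant.det], rule eq_matI) (auto simp: carrier_matD[of "G T" n n])
    finally show ?thesis by (simp add: ndet_def A_def C_def)
  qed
  \<comment> \<open>As \<open>\<mu> k \<le> \<nu>\<close>, the remainder stays negligible under the
    scaling of row \<open>k\<close>.\<close>
  have rl: "((\<lambda>T. exp (\<mu> k * T) * r (T + s)) \<longlongrightarrow> 0) at_top" if "k < n" for k s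
  proof -
    have "((\<lambda>T. exp (- \<nu> * s) * (r (T + s) * exp (\<nu> * (T + s)))) \<longlongrightarrow> exp (- \<nu> * s) * 0) at_top"
      unfolding r_def by (intro tendsto_mult tendsto_const filterlim_compose[OF lim, of "\<lambda>T. T + s"]) real_asymp
    moreover have "exp (- \<nu> * s) * (r (T + s) * exp (\<nu> * (T + s))) = exp (\<nu> * T) * r (T + s)" for T
      by (simp add: distrib_left exp_add exp_minus)
    ultimately have "((\<lambda>T. exp (\<nu> * T) * r (T + s)) \<longlongrightarrow> 0) at_top"
      by (simp only: mult_zero_right)
    then have "((\<lambda>T. norm (exp (\<nu> * T) * r (T + s))) \<longlongrightarrow> 0) at_top"
      by (rule tendsto_norm_zero)
    moreover have "\<forall>\<^sub>F T in at_top. norm (exp (\<mu> k * T) * r (T + s)) \<le> norm (exp (\<nu> * T) * r (T + s))"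
      using eventually_ge_at_top[of 0]
    proof eventually_elim
      case (elim T)
      then show ?case using mu(2)[OF that] by (auto simp: abs_mult intro!: mult_right_mono)
    qed
    ultimately show ?thesis
      by (rule Lim_null_comparison[rotated])
  qed
  have "((\<lambda>T. ndet n (\<lambda>k l. exp (\<mu> k * T) * 1 * g T k l)) \<longlongrightarrow> ndet n (\<lambda>k l. if k = l then p k else 0)) at_top"
  proof (rule tendsto_ndet)
    fix k l assume kl: "k < n" "l < n"
    have "exp (\<mu> k * T) * 1 * g T k l = (if k = l then p k else 0) +
        (\<Sum>j<n. (\<Sum>i<n. A' $$ (k, i) * (exp (\<mu> k * T) * r (T + (real i - real j)))) * C' $$ (j, l))" for T
    proof -
      have "g T k l = (if k = l then p k * exp (- \<mu> k * T) else 0) +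
          (\<Sum>j<n. (\<Sum>i<n. A' $$ (k, i) * r (T + (real i - real j))) * C' $$ (j, l))"
      proof -
        have "(A' * R T * C') $$ (k, l) = (\<Sum>j<n. (A' * R T) $$ (k, j) * C' $$ (j, l))"
          by (rule index_mult_mat_sum) (use kl in \<open>auto intro: mult_carrier_mat[of _ n n]\<close>)
        also have "\<dots> = (\<Sum>j<n. (\<Sum>i<n. A' $$ (k, i) * R T $$ (i, j)) * C' $$ (j, l))"
          using kl by (intro sum.cong refl arg_cong2[where f = "(*)"] index_mult_mat_sum) auto
        also have "\<dots> = (\<Sum>j<n. (\<Sum>i<n. A' $$ (k, i) * r (T + (real i - real j))) * C' $$ (j, l))"
          by (simp add: R_def add_diff_eq)
        finally show ?thesis
          using kl carrier_matD[OF X] by (simp add: g_def G_def D_def)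
      qed
      moreover have "exp (\<mu> k * T) * (p k * exp (- \<mu> k * T)) = p k"
        by (simp add: mult.left_commute flip: exp_add)
      moreover have "exp (\<mu> k * T) * (\<Sum>j<n. (\<Sum>i<n. A' $$ (k, i) * r (T + (real i - real j))) * C' $$ (j, l))
          = (\<Sum>j<n. (\<Sum>i<n. A' $$ (k, i) * (exp (\<mu> k * T) * r (T + (real i - real j)))) * C' $$ (j, l))"
        by (simp add: sum_distrib_left sum_distrib_right mult.left_commute mult.assoc)
      ultimately show ?thesis
        by (cases "k = l") (simp_all only: mult_1_right distrib_left mult_zero_right simp_thms if_True if_False)
    qed
    moreover have "((\<lambda>T. (if k = l then p k else 0) +
        (\<Sum>j<n. (\<Sum>i<n. A' $$ (k, i) * (exp (\<mu> k * T) * r (T + (real i - real j)))) * C' $$ (j, l)))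
        \<longlongrightarrow> (if k = l then p k else 0) + (\<Sum>j<n. (\<Sum>i<n. A' $$ (k, i) * 0) * C' $$ (j, l))) at_top"
      by (intro tendsto_intros rl kl)
    ultimately show "((\<lambda>T. exp (\<mu> k * T) * 1 * g T k l) \<longlongrightarrow> (if k = l then p k else 0)) at_top"
      by simp
  qed
  then have "((\<lambda>T. ndet n a * ((\<Prod>k<n. exp (\<mu> k * T)) * ndet n (g T))) \<longlongrightarrow> ndet n a * (\<Prod>k<n. p k)) at_top"
    unfolding ndet_scale ndet_diagonal by (intro tendsto_mult tendsto_const) simp
  then have "0 \<le> ndet n a * (\<Prod>k<n. p k)"
  proof (rule tendsto_lowerbound)
    have "0 \<le> ndet n a * ((\<Prod>k<n. exp (\<mu> k * T)) * ndet n (g T))" for T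
    proof -
      have "0 \<le> ndet n a * ndet n (g T)" using det[of T] detC by (simp add: zero_le_mult_iff)
      moreover have "0 \<le> (\<Prod>k<n. exp (\<mu> k * T))" by (intro prod_nonneg) auto
      ultimately have "0 \<le> (\<Prod>k<n. exp (\<mu> k * T)) * (ndet n a * ndet n (g T))" by simp
      then show ?thesis by (simp add: ac_simps)
    qed
    then show "\<forall>\<^sub>F T in at_top. 0 \<le> ndet n a * ((\<Prod>k<n. exp (\<mu> k * T)) * ndet n (g T))" by simp
  qed auto
  then show ?thesis by (simp add: a_def)
qed

text \<open>The nodes \<open>- i\<close> are the increasing nodes \<open>i - 2\<close> read
  backwards, and reversing three rows is one transposition.\<close>

lemma ndet_3_exp_reverse:
  assumes "strict_mono_on {..<3} \<mu>"
  shows "ndet 3 (\<lambda>i k. exp (- (real i * \<mu> k))) < 0"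
proof -
  define a where "a = (\<lambda>i k. exp ((real i - 2) * \<mu> k))"
  have "0 < ndet 3 a"
    unfolding a_def by (rule ndet_exp_pos) (use assms in \<open>auto simp: strict_mono_on_def\<close>)
  also have "ndet 3 a = - ndet 3 (\<lambda>i. a (2 - i))"
    by (simp add: ndet_3 numeral_2_eq_2 algebra_simps)
  also have "ndet 3 (\<lambda>i. a (2 - i)) = ndet 3 (\<lambda>i k. exp (- (real i * \<mu> k)))"
    by (rule ndet_cong) (auto simp: a_def of_nat_diff)
  finally show ?thesis by simp
qed

text \<open>Reversing four rows takes two transpositions, so the positive sign survives.\<close>

lemma ndet_4_exp_reverse:
  assumes "strict_mono_on {..<4} \<mu>"
  shows "0 < ndet 4 (\<lambda>i k. exp (- (real i * \<mu> k)))"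
proof -
  define a where "a = (\<lambda>i k. exp ((real i - 3) * \<mu> k))"
  have "0 < ndet 4 a"
    unfolding a_def by (rule ndet_exp_pos) (use assms in \<open>auto simp: strict_mono_on_def\<close>)
  also have "ndet 4 a = ndet 4 (\<lambda>i. a (3 - i))"
    by (simp add: eval_nat_numeral ndet_Suc algebra_simps)
  also have "ndet 4 (\<lambda>i. a (3 - i)) = ndet 4 (\<lambda>i k. exp (- (real i * \<mu> k)))"
    by (rule ndet_cong) (auto simp: a_def of_nat_diff)
  finally show ?thesis .
qed

section \<open>Transforms of totally positive functions\<close>

text \<open>At least one of \<open>- 1 + x\<close> and \<open>- 1 - x\<close> is negative, so the
  sum of \<open>f\<close> at these points is integrable and at least \<open>e\<close> on the whole
  line, which is impossible for \<open>e > 0\<close>.\<close>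

lemma integrable_half_line_bound:
  fixes f :: "real \<Rightarrow> real"
  assumes f: "integrable lebesgue f" and "\<And>x. 0 \<le> f x" and e: "\<And>x. x < 0 \<Longrightarrow> e \<le> f x"
  shows "e \<le> 0"
proof (rule ccontr)
  assume "\<not> e \<le> 0"
  have "integrable lebesgue (\<lambda>x. f (- 1 + 1 * x) + f (- 1 + (- 1) * x))"
    by (intro Bochner_Integration.integrable_add lebesgue_integrable_real_affine f) auto
  then have "integrable lebesgue (\<lambda>x::real. e)"
  proof (rule Bochner_Integration.integrable_bound)
    have "e \<le> f (- 1 + 1 * x) + f (- 1 + (- 1) * x)" for x
      using assms(2)[of "- 1 + 1 * x"] assms(2)[of "- 1 + (- 1) * x"]
        e[of "- 1 + 1 * x"] e[of "- 1 + (- 1) * x"] by (cases "x < 1") auto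
    then show "AE x in lebesgue. norm e \<le> norm (f (- 1 + 1 * x) + f (- 1 + (- 1) * x))"
      using \<open>\<not> e \<le> 0\<close> by (auto intro!: AE_I2 order_trans[OF _ abs_ge_self])
  qed simp
  then have "integrable lebesgue (\<lambda>x::real. e / e)"
    by (rule Bochner_Integration.integrable_divide)
  then have "(UNIV :: real set) \<in> lmeasurable"
    using \<open>\<not> e \<le> 0\<close> by (simp add: lmeasurable_iff_integrable)
  then show False by (auto dest: fmeasurableD2)
qed

lemma tn_two_by_two:
  assumes "tn f" "s < t" "u < v"
  shows "f (s - v) * f (t - u) \<le> f (s - u) * f (t - v)"
proof -
  have "strict_mono_on {..<2} (\<lambda>i::nat. if i = 0 then a else b)" if "a < b" for a b :: real
    using that by (auto simp: strict_mono_on_def)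
  from tnD[OF assms(1) this this, OF assms(2) assms(3)] show ?thesis
    by (simp add: ndet_2)
qed

lemma gauss_level:
  assumes "0 < v" "v \<le> (c::real)"
  shows "\<exists>x\<ge>0. v = c * exp (- x\<^sup>2)"
  using assms by (intro exI[of _ "sqrt (ln (c / v))"]) (auto simp: exp_minus)

text \<open>Both preservation hypotheses imply this one, which constrains \<open>F\<close> on \<open>(0, \<infinity>)\<close> only.\<close>

locale polya_transform =
  fixes F :: "real \<Rightarrow> real"
  assumes transform: "totally_positive_polya_frequency \<Lambda> \<Longrightarrow> polya_frequency (F \<circ> \<Lambda>)"
begin

section \<open>Monotonicity, positivity and continuity from Gaussians\<close>

lemma tn_transform: "totally_positive_polya_frequency \<Lambda> \<Longrightarrow> tn (\<lambda>x. F (\<Lambda> x))"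
  using transform[of \<Lambda>] by (simp add: polya_frequency_def o_def)

lemma F_nonneg:
  assumes "0 < v"
  shows "0 \<le> F v"
  using transform[OF tppf_gauss[OF assms]] by (auto simp: polya_frequency_def dest: spec[of _ 0])

text \<open>The Gaussian of height \<open>v\<close> takes the value \<open>u\<close> at
  \<open>x\<close> and \<open>- x\<close>; its transformed minor with nodes 0 and \<open>x\<close>
  on both sides is \<open>(F v)\<^sup>2 - (F u)\<^sup>2\<close>.\<close>

lemma F_mono:
  assumes "0 < u" "u \<le> v"
  shows "F u \<le> F v"
proof -
  obtain x where x: "0 \<le> x" "u = v * exp (- x\<^sup>2)"
    using gauss_level[OF assms] by blast
  show ?thesis
  proof (cases "x = 0")
    case False
    with tn_two_by_two[OF tn_transform[OF tppf_gauss[of v]], of 0 x 0 x] assms x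
    have "(F u)\<^sup>2 \<le> (F v)\<^sup>2" by (auto simp: power2_eq_square)
    moreover have "0 \<le> F v" using assms by (intro F_nonneg) simp
    ultimately show ?thesis by (rule power2_le_imp_le)
  qed (use x in auto)
qed

text \<open>\<open>F\<close> cannot vanish at all values of the Gaussian of height \<open>v\<close>,
  and these are at most \<open>v\<close>.\<close>

lemma F_pos:
  assumes "0 < v"
  shows "0 < F v"
proof -
  obtain a where "F (v * exp (- a\<^sup>2)) \<noteq> 0"
    using transform[OF tppf_gauss[OF assms]] by (auto simp: polya_frequency_def)
  then have "0 < F (v * exp (- a\<^sup>2))"
    using F_nonneg[of "v * exp (- a\<^sup>2)"] assms by auto
  also have "\<dots> \<le> F v" by (rule F_mono) (use assms in auto)
  finally show ?thesis .
qed

text \<open>If \<open>F\<close> stayed above some \<open>e > 0\<close>, its composition with a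
  Gaussian would not be integrable; monotonicity does the rest.\<close>

lemma F_tendsto_0: "(F \<longlongrightarrow> 0) (at_right 0)"
proof (rule order_tendstoI)
  fix e :: real assume "0 < e"
  have "\<exists>v>0. F v < e"
  proof (rule ccontr)
    assume "\<not> (\<exists>v>0. F v < e)"
    then have le: "e \<le> F v" if "0 < v" for v using that by (meson not_less)
    have "integrable lebesgue (\<lambda>x. F (1 * exp (- x\<^sup>2)))"
      using transform[OF tppf_gauss[of 1]] by (simp add: polya_frequency_def o_def)
    then have "e \<le> 0"
      by (rule integrable_half_line_bound) (use le \<open>0 < e\<close> in \<open>auto intro!: F_nonneg\<close>)
    then show False using \<open>0 < e\<close> by simp
  qed
  then obtain v where v: "0 < v" "F v < e" by blast
  show "eventually (\<lambda>x. F x < e) (at_right 0)"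
    using eventually_at_right_real[OF v(1)]
  proof eventually_elim
    case (elim x)
    then have "F x \<le> F v" by (intro F_mono) auto
    then show ?case using v by simp
  qed
next
  fix e :: real assume "e < 0"
  show "eventually (\<lambda>x. e < F x) (at_right 0)"
    using eventually_at_right_less[of 0]
  proof eventually_elim
    case (elim x)
    then show ?case using \<open>e < 0\<close> F_pos[of x] by simp
  qed
qed

text \<open>A jump of the monotone function \<open>F\<close> at \<open>u\<close> would contradict the midpoint log-concavity of
  \<open>F (c exp (- x\<^sup>2))\<close> for three equally spaced points \<open>x\<close>, only one
  value being on the high side of the jump.\<close>

lemma F_midpoint:
  assumes "0 < v" "v < u"
  obtains m w where "0 < m" "m < u" "u < w" "F v * F w \<le> (F m)\<^sup>2"
proof -
  \<comment> \<open>With height \<open>2 * u\<close> the level \<open>u\<close> is attained at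
    \<open>X u > 0\<close>, which leaves room on the inner side.\<close>
  define c where "c = 2 * u"
  define X where "X t = sqrt (ln (c / t))" for t
  have X: "c * exp (- (X t)\<^sup>2) = t" if "0 < t" "t \<le> c" for t
    using that by (simp add: X_def exp_minus)
  have lt: "0 < X u" "X u < X v"
  proof -
    have "c / u < c / v"
      using assms by (intro divide_strict_left_mono) (simp_all add: c_def)
    moreover have "c / u = 2" using assms by (simp add: c_def)
    ultimately show "0 < X u" "X u < X v" by (simp_all add: X_def)
  qed
  \<comment> \<open>So small that \<open>z = X u - d\<close> is nonnegative while the midpoint
    \<open>y\<close> of \<open>z\<close> and \<open>X v\<close> still lies beyond
    \<open>X u\<close>.\<close>
  define d where "d = min (X u) ((X v - X u) / 4)"
  have d: "0 < d" using lt by (simp add: d_def)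
  have "d \<le> X u" "d \<le> (X v - X u) / 4"
    unfolding d_def by (rule min.cobounded1, rule min.cobounded2)
  note d = d this
  define y where "y = X u + (X v - X u - d) / 2"
  define z where "z = X u - d"
  have y: "X u < y" and z: "0 \<le> z" "z < X u" "2 * y = X v + z"
    using d lt by (auto simp: y_def z_def field_simps)
  have decr: "c * exp (- b\<^sup>2) < c * exp (- a\<^sup>2)" if "0 \<le> a" "a < b" for a b
    using that assms by (simp add: c_def power_strict_mono)
  have "F (c * exp (- (0 - (- z))\<^sup>2)) * F (c * exp (- ((X v - y) - (- y))\<^sup>2))
      \<le> F (c * exp (- (0 - (- y))\<^sup>2)) * F (c * exp (- ((X v - y) - (- z))\<^sup>2))"
  proof -
    have "0 < X v - y" "- y < - z" using y z lt by auto
    from tn_two_by_two[OF tn_transform[OF tppf_gauss[of c]] this] show ?thesis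
      using assms by (simp add: c_def)
  qed
  moreover have "X v - y + z = y" using z by simp
  ultimately have "F v * F (c * exp (- z\<^sup>2)) \<le> (F (c * exp (- y\<^sup>2)))\<^sup>2"
    using X[of v] assms by (simp add: c_def power2_eq_square mult.commute)
  moreover have "c * exp (- (X u)\<^sup>2) = u" by (rule X) (use assms in \<open>auto simp: c_def\<close>)
  then have "c * exp (- y\<^sup>2) < u" "u < c * exp (- z\<^sup>2)"
    using decr[of "X u" y] decr[of z "X u"] y z lt by auto
  ultimately show thesis
    using that[of "c * exp (- y\<^sup>2)" "c * exp (- z\<^sup>2)"] assms by (simp add: c_def)
qed

text \<open>The one-sided limits satisfy \<open>L \<le> F u \<le> R\<close>.
  \<open>F_midpoint\<close> gives \<open>F v * R \<le> L\<^sup>2\<close> for positive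
  \<open>v < u\<close>, and the supremum over \<open>v\<close> yields
  \<open>R \<le> L\<close>.\<close>

lemma F_isCont:
  assumes "0 < u"
  shows "isCont F u"
proof -
  define L where "L = (SUP v\<in>{0<..<u}. F v)"
  define R where "R = (INF w\<in>{u<..}. F w)"
  have bdd: "bdd_above (F ` {0<..<u})" "bdd_below (F ` {u<..})"
  proof -
    show "bdd_above (F ` {0<..<u})" by (rule bdd_aboveI[of _ "F u"]) (auto intro: F_mono)
    show "bdd_below (F ` {u<..})" by (rule bdd_belowI[of _ 0]) (use assms in \<open>auto intro!: F_nonneg\<close>)
  qed
  have ne: "{0<..<u} \<noteq> {}" "{u<..} \<noteq> {}" using assms by (auto simp: dense)
  have L: "F v \<le> L" if "0 < v" "v < u" for v
    unfolding L_def using that bdd by (intro cSUP_upper) auto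
  have R: "R \<le> F w" if "u < w" for w
    unfolding R_def using that bdd by (intro cINF_lower) auto
  have LF: "L \<le> F u" unfolding L_def using ne assms by (intro cSUP_least F_mono) auto
  have FR: "F u \<le> R" unfolding R_def using ne assms by (intro cINF_greatest F_mono) auto
  have "0 < F (u / 2)" using assms by (intro F_pos) auto
  also have "\<dots> \<le> L" using assms by (intro L) auto
  finally have "0 < L" .
  have "0 < R" using F_pos[OF assms] FR by simp
  have "F v \<le> L\<^sup>2 / R" if v: "0 < v" "v < u" for v
  proof -
    obtain m w where mw: "0 < m" "m < u" "u < w" "F v * F w \<le> (F m)\<^sup>2"
      using F_midpoint[OF v] by blast
    have "F v * R \<le> F v * F w" using R[OF mw(3)] F_pos[OF v(1)] by simp
    also have "\<dots> \<le> (F m)\<^sup>2" by (rule mw)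
    also have "\<dots> \<le> L\<^sup>2" using L[OF mw(1,2)] F_pos[OF mw(1)] by (intro power_mono) auto
    finally show ?thesis using \<open>0 < R\<close> by (simp add: field_simps)
  qed
  then have "L \<le> L\<^sup>2 / R" unfolding L_def using ne by (intro cSUP_least) (auto simp flip: L_def)
  then have "R \<le> L" using \<open>0 < L\<close> \<open>0 < R\<close> by (simp add: field_simps power2_eq_square)
  with LF FR have eq: "L = F u" "R = F u" by auto
  show ?thesis
    unfolding isCont_def
  proof (rule order_tendstoI)
    fix e assume "e < F u"
    then obtain v where v: "0 < v" "v < u" "e < F v"
      using less_cSUP_iff[OF ne(1) bdd(1), of e] eq by (auto simp: L_def)
    have "eventually (\<lambda>x. v < x) (at u)"
      using v(2) by (rule order_tendstoD[OF tendsto_ident_at])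
    then show "eventually (\<lambda>x. e < F x) (at u)"
    proof eventually_elim
      case (elim x)
      then have "F v \<le> F x" using v by (intro F_mono) auto
      then show ?case using v by simp
    qed
  next
    fix e assume "F u < e"
    then obtain w where w: "u < w" "F w < e"
      using cINF_less_iff[OF ne(2) bdd(2), of e] eq by (auto simp: R_def)
    have "eventually (\<lambda>x. x < w) (at u)" "eventually (\<lambda>x. 0 < x) (at u)"
      using w(1) assms by (auto intro: order_tendstoD[OF tendsto_ident_at])
    then show "eventually (\<lambda>x. F x < e) (at u)"
    proof eventually_elim
      case (elim x)
      then have "F x \<le> F w" by (intro F_mono) auto
      then show ?case using w by simp
    qed
  qed
qed

end

section \<open>Cauchy's functional equation, the power law and its exponent\<close>

lemma antimono_additive_linear:
  fixes h :: "real \<Rightarrow> real"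
  assumes add: "\<And>x y. h (x + y) = h x + h y" and mono: "\<And>x y. x \<le> y \<Longrightarrow> h y \<le> h x"
  shows "h x = x * h 1"
proof -
  have h0: "h 0 = 0" using add[of 0 0] by simp
  have nat: "h (real n * x) = real n * h x" for n x
    by (induction n) (simp_all add: h0 add algebra_simps)
  have "h (- x) = - h x" for x using add[of x "- x"] h0 by simp
  then have int: "h (of_int m) = of_int m * h 1" for m
    using nat[of "nat m" 1] nat[of "nat (- m)" 1] by (cases "0 \<le> m") auto
  \<comment> \<open>Comparison at the two integers around \<open>n * x\<close> puts
    \<open>n * h x\<close> and \<open>n * x * h 1\<close> in one interval of length
    \<open>- h 1\<close>; since \<open>n\<close> is arbitrary, \<open>h x = x * h 1\<close>.\<close>
  have bound: "real n * \<bar>h x - x * h 1\<bar> \<le> - h 1" for n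
  proof -
    define N where "N = \<lfloor>real n * x\<rfloor>"
    have N: "of_int N \<le> real n * x" "real n * x \<le> of_int N + 1"
      unfolding N_def by linarith+
    have "h 1 \<le> 0" using mono[of 0 1] h0 by simp
    have "of_int N * h 1 + h 1 \<le> real n * h x" "real n * h x \<le> of_int N * h 1"
      using mono[OF N(1)] mono[OF N(2)] by (auto simp: nat int add)
    moreover have "of_int N * h 1 + h 1 \<le> real n * x * h 1" "real n * x * h 1 \<le> of_int N * h 1"
      using mult_right_mono_neg[OF N(1) \<open>h 1 \<le> 0\<close>] mult_right_mono_neg[OF N(2) \<open>h 1 \<le> 0\<close>]
      by (auto simp: algebra_simps)
    ultimately have "\<bar>real n * h x - real n * x * h 1\<bar> \<le> - h 1" by linarith
    moreover have "real n * \<bar>h x - x * h 1\<bar> = \<bar>real n * h x - real n * x * h 1\<bar>"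
    proof -
      have "real n * \<bar>h x - x * h 1\<bar> = \<bar>real n * (h x - x * h 1)\<bar>" by (simp add: abs_mult)
      then show ?thesis by (simp only: right_diff_distrib mult.assoc)
    qed
    ultimately show ?thesis by simp
  qed
  show ?thesis
  proof (rule ccontr)
    assume "h x \<noteq> x * h 1"
    then obtain n where "- h 1 < real n * \<bar>h x - x * h 1\<bar>"
      using reals_Archimedean3[of "\<bar>h x - x * h 1\<bar>"] by auto
    with bound[of n] show False by simp
  qed
qed

text \<open>The gaps 2 and 5 between the rates satisfy \<open>2 * 2 < 5 < 3 * 2\<close>, so that the first four
  exponents of the expansion are \<open>\<alpha> / 2 + {0, 2, 4, 5}\<close>, and the sign pattern of the
  coefficients is \<open>+ - -\<close> for \<open>\<alpha> < 1\<close> and \<open>+ - + +\<close> for \<open>1 < \<alpha>\<close>.  Total nonnegativity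
  would require alternating signs.\<close>

lemma hypoexp_powr_expansion_3:
  assumes "0 < \<alpha>" "\<alpha> < 1"
  shows "((\<lambda>x. ((10 * hypoexp x) powr \<alpha> - (exp (- (\<alpha> / 2) * x)
      - 10 / 3 * \<alpha> * exp (- (\<alpha> / 2 + 2) * x)
      + 50 / 9 * \<alpha> * (\<alpha> - 1) * exp (- (\<alpha> / 2 + 4) * x)))
      * exp ((\<alpha> / 2 + 4) * x)) \<longlongrightarrow> 0) at_top"
  unfolding hypoexp_def using assms by real_asymp

text \<open>Up to terms with the factor \<open>exp (- exp x)\<close>, \<open>10 * hypoexp x\<close>
  is \<open>exp (- x / 2) * (1 - 10 / 3 * exp (- 2 * x) + 80 * exp (- 5 * x))\<close>. The binomial
  series gives the coefficients; its next contribution has relative order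
  \<open>exp (- 6 * x)\<close>.\<close>

lemma hypoexp_powr_expansion_4:
  assumes "1 < \<alpha>"
  shows "((\<lambda>x. ((10 * hypoexp x) powr \<alpha> - (exp (- (\<alpha> / 2) * x)
      - 10 / 3 * \<alpha> * exp (- (\<alpha> / 2 + 2) * x)
      + 50 / 9 * \<alpha> * (\<alpha> - 1) * exp (- (\<alpha> / 2 + 4) * x)
      + 80 * \<alpha> * exp (- (\<alpha> / 2 + 5) * x)))
      * exp ((\<alpha> / 2 + 5) * x)) \<longlongrightarrow> 0) at_top"
  unfolding hypoexp_def using assms by real_asymp

context polya_transform
begin

text \<open>As \<open>q\<close> grows, the smoothed exponentials tend to
  \<open>c * exp (- z)\<close> for \<open>z > 0\<close>, where \<open>F\<close> is continuous, and
  to 0 from the right for \<open>z < 0\<close>, where \<open>F_tendsto_0\<close> applies. At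
  \<open>z = 0\<close> they stay at \<open>c * (1 - exp (- 1))\<close>, a case excluded by
  \<open>ne\<close>.\<close>

lemma exp_minor_nonneg:
  assumes "0 < c" and xy: "strict_mono_on {..<n} x" "strict_mono_on {..<n} y"
    and ne: "\<And>i j. i < n \<Longrightarrow> j < n \<Longrightarrow> x i \<noteq> y j"
  shows "0 \<le> ndet n (\<lambda>i j. if y j < x i then F (c * exp (y j - x i)) else 0)"
proof (rule tendsto_lowerbound)
  define f where "f q z = c * exp (- z) * (1 - exp (- exp (q * z)))" for q z :: real
  show "((\<lambda>q. ndet n (\<lambda>i j. F (f q (x i - y j)))) \<longlongrightarrow>
      ndet n (\<lambda>i j. if y j < x i then F (c * exp (y j - x i)) else 0)) at_top"
  proof (rule tendsto_ndet)
    fix i j assume "i < n" "j < n"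
    define z where "z = x i - y j"
    have "z \<noteq> 0" using ne[OF \<open>i < n\<close> \<open>j < n\<close>] by (simp add: z_def)
    have "((\<lambda>q. F (f q z)) \<longlongrightarrow> (if 0 < z then F (c * exp (- z)) else 0)) at_top"
    proof (cases "0 < z")
      case True
      have "((\<lambda>q. f q z) \<longlongrightarrow> c * exp (- z)) at_top"
        unfolding f_def using True by real_asymp
      from isCont_tendsto_compose[OF F_isCont this] show ?thesis
        using True \<open>0 < c\<close> by simp
    next
      case False
      with \<open>z \<noteq> 0\<close> have "z < 0" by simp
      then have "((\<lambda>q. f q z) \<longlongrightarrow> 0) at_top"
        unfolding f_def by real_asymp
      moreover have "0 < f q z \<and> f q z \<noteq> 0" for q
        using \<open>0 < c\<close> by (simp add: f_def)
      ultimately have "filterlim (\<lambda>q. f q z) (at_right 0) at_top"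
        by (auto simp: filterlim_at)
      from filterlim_compose[OF F_tendsto_0 this] show ?thesis using False by simp
    qed
    then show "((\<lambda>q. F (f q (x i - y j))) \<longlongrightarrow> (if y j < x i then F (c * exp (y j - x i)) else 0)) at_top"
      unfolding z_def diff_gt_0_iff_gt minus_diff_eq .
  qed
  show "\<forall>\<^sub>F q in at_top. 0 \<le> ndet n (\<lambda>i j. F (f q (x i - y j)))"
    using eventually_gt_at_top[of 1]
  proof eventually_elim
    case (elim q)
    show ?case
      using tnD[OF tn_transform[OF tppf_smoothed_exp[OF \<open>0 < c\<close> elim]] xy] by (simp add: f_def)
  qed
qed simp

lemma F_exp_log_concave:
  assumes "0 < s" "0 < d"
  shows "F (exp (- t)) * F (exp (- (t + s + d))) \<le> F (exp (- (t + d))) * F (exp (- (t + s)))"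
proof -
  define f where "f z = F (exp (1 - t - z))" for z
  have f1: "f 1 = F (exp (- t))" "f (1 + z) = F (exp (- (t + z)))" for z
    by (simp_all add: f_def)
  \<comment> \<open>The offset 1, compensated in \<open>exp (1 - t)\<close>, puts all row nodes to
    the right of all column nodes, so nothing is cut off.\<close>
  define x where "x i = (if i = 0 then 1 else 1 + s)" for i :: nat
  define y where "y i = (if i = 0 then - d else 0)" for i :: nat
  have "0 \<le> ndet 2 (\<lambda>i j. if y j < x i then F (exp (1 - t) * exp (y j - x i)) else 0)"
    by (rule exp_minor_nonneg) (use assms in \<open>auto simp: x_def y_def strict_mono_on_def\<close>)
  also have "ndet 2 (\<lambda>i j. if y j < x i then F (exp (1 - t) * exp (y j - x i)) else 0) =
      ndet 2 (\<lambda>i j. if y j < x i then f (x i - y j) else 0)"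
    by (rule ndet_cong) (auto simp: f_def algebra_simps simp flip: exp_add)
  also have "\<dots> = f (1 + d) * f (1 + s) - f 1 * f (1 + s + d)"
    using assms by (simp add: ndet_2 x_def y_def)
  finally show ?thesis by (simp only: f1 add.assoc diff_ge_0_iff_ge)
qed

text \<open>Two rows on either side of a column isolate the jump of the one-sided exponential; what is
  left of the minor is a two by two determinant of the sign opposite to the previous one.\<close>

lemma F_exp_log_convex:
  assumes "0 < s" "0 < d"
  shows "F (exp (- (t + d))) * F (exp (- (t + s))) \<le> F (exp (- t)) * F (exp (- (t + s + d)))"
proof -
  define f where "f z = F (exp (1 - t - z))" for z
  have f1: "f 1 = F (exp (- t))" "f (1 + z) = F (exp (- (t + z)))" for z
    by (simp_all add: f_def)
  \<comment> \<open>The minor with rows at \<open>- e\<close>, \<open>e\<close>, \<open>s\<close>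
    and columns at \<open>- 1 - d\<close>, \<open>- 1\<close>, 0, where only the entry for
    \<open>- e\<close> and 0 is cut off. At \<open>e = 0\<close> the terms with \<open>f s\<close>
    cancel.\<close>
  define D where "D e = f (1 + d - e) * (f (1 + e) * f s - f e * f (1 + s))
      - f (1 - e) * (f (1 + d + e) * f s - f e * f (1 + s + d))" for e
  have f: "isCont f z" for z
    unfolding f_def by (rule isCont_o2[of _ "\<lambda>z. exp (1 - t - z)"]) (auto intro!: F_isCont)
  have "0 \<le> D e" if e: "0 < e" "e < 1" "e < s" for e
  proof -
    define x where "x i = (if i = 0 then - e else if i = 1 then e else s)" for i :: nat
    define y where "y i = (if i = 0 then - 1 - d else if i = 1 then - 1 else 0)" for i :: nat
    have "0 \<le> ndet 3 (\<lambda>i j. if y j < x i then F (exp (1 - t) * exp (y j - x i)) else 0)"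
      by (rule exp_minor_nonneg) (use assms e in \<open>auto simp: x_def y_def strict_mono_on_def\<close>)
    also have "ndet 3 (\<lambda>i j. if y j < x i then F (exp (1 - t) * exp (y j - x i)) else 0) =
        ndet 3 (\<lambda>i j. if y j < x i then f (x i - y j) else 0)"
      by (rule ndet_cong) (auto simp: f_def algebra_simps simp flip: exp_add)
    also have "\<dots> = D e"
      using assms e by (simp add: ndet_3 x_def y_def D_def algebra_simps)
    finally show ?thesis .
  qed
  then have "\<forall>\<^sub>F e in at_right 0. 0 \<le> D e"
    using eventually_at_right_real[of 0 "min 1 s"] assms by (auto elim!: eventually_mono)
  moreover have "isCont D 0"
    unfolding D_def
    by (intro isCont_diff isCont_mult isCont_o2[OF _ f] isCont_add continuous_ident continuous_const)
  then have "(D \<longlongrightarrow> D 0) (at_right 0)"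
    by (auto simp: isCont_def intro: tendsto_within_subset)
  ultimately have "0 \<le> D 0"
    by (intro tendsto_lowerbound) auto
  also have "D 0 = f 0 * (f 1 * f (1 + s + d) - f (1 + d) * f (1 + s))"
    by (simp add: D_def algebra_simps)
  finally have "0 \<le> f 1 * f (1 + s + d) - f (1 + d) * f (1 + s)"
    using F_pos[of "exp (1 - t)"] by (simp add: f_def zero_le_mult_iff)
  then show ?thesis by (simp only: f1 add.assoc diff_ge_0_iff_ge)
qed

text \<open>Log-concavity and log-convexity make the increments of \<open>l\<close> independent of
  the base point, so \<open>l z - l 0\<close> is additive and decreasing, hence linear. Its slope is
  \<open>- \<alpha>\<close>, and \<open>F_tendsto_0\<close> forces
  \<open>\<alpha> > 0\<close>.\<close>

lemma F_power:
  obtains \<alpha> where "0 < \<alpha>" "\<And>u. 0 < u \<Longrightarrow> F u = F 1 * u powr \<alpha>"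
proof -
  define l where "l z = ln (F (exp (- z)))" for z
  have ne: "F (exp z) \<noteq> 0" for z using F_pos[of "exp z"] by simp
  have step: "l (a + d) - l a = l (b + d) - l b" if "0 < d" "a < b" for a b d
  proof -
    have "F (exp (- a)) * F (exp (- (b + d))) = F (exp (- (a + d))) * F (exp (- b))"
      using F_exp_log_concave[of "b - a" d a] F_exp_log_convex[of "b - a" d a] that by simp
    then have "ln (F (exp (- a)) * F (exp (- (b + d)))) = ln (F (exp (- (a + d))) * F (exp (- b)))"
      by simp
    then show ?thesis
      by (simp add: l_def ln_mult ne)
  qed
  then have step': "l (a + d) - l a = l (b + d) - l b" if "0 < d" for a b d
    using that by (metis linorder_neqE_linordered_idom)
  have step'': "l (a + d) - l a = l (b + d) - l b" for a b d
  proof (cases d "0::real" rule: linorder_cases)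
    case less
    then show ?thesis using step'[of "- d" "a + d" "b + d"] by simp
  qed (use step' in auto)
  define h where "h z = l z - l 0" for z
  have "h (x + y) = h x + h y" for x y
    using step''[of x y 0] by (simp add: h_def)
  moreover have "h y \<le> h x" if "x \<le> y" for x y
    using that F_mono[of "exp (- y)" "exp (- x)"] by (simp add: h_def l_def F_pos)
  ultimately have h: "h x = x * h 1" for x
    by (rule antimono_additive_linear)
  define \<alpha> where "\<alpha> = - h 1"
  have F: "F u = F 1 * u powr \<alpha>" if "0 < u" for u
  proof -
    have "ln (F u) - ln (F 1) = ln u * \<alpha>"
      using h[of "- ln u"] that by (simp add: h_def l_def \<alpha>_def algebra_simps)
    then have "exp (ln (F u)) = exp (ln (F 1) + ln u * \<alpha>)" by simp
    then show ?thesis using that F_pos[of u] F_pos[of 1] by (simp add: exp_add powr_def mult.commute)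
  qed
  have "0 < \<alpha>"
  proof (rule ccontr)
    assume "\<not> 0 < \<alpha>"
    then have le: "F 1 \<le> F u" if "0 < u" "u < 1" for u
      using F[of u] F_pos[of 1] that powr_mono'[of \<alpha> 0 u] by (simp add: mult_le_cancel_left1)
    have "\<forall>\<^sub>F u in at_right 0. F u < F 1"
      using F_pos[of 1] by (intro order_tendstoD[OF F_tendsto_0]) simp
    then have "\<forall>\<^sub>F u in at_right 0. F u < F 1 \<and> u \<in> {0<..<1}"
      using eventually_at_right_real[of 0 1] by (intro eventually_conj) auto
    from eventually_happens[OF this] obtain u where "F u < F 1" "0 < u" "u < 1"
      by auto
    then show False using le[of u] by simp
  qed
  then show thesis using F that by blast
qed

text \<open>The factor \<open>10 powr \<alpha> / F 1\<close> normalizes the leading coefficient of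
  the expansion to 1.\<close>

lemma tn_hypoexp_powr:
  assumes "\<And>u. 0 < u \<Longrightarrow> F u = F 1 * u powr \<alpha>"
  shows "tn (\<lambda>x. (10 * hypoexp x) powr \<alpha>)"
proof -
  have pos: "0 < hypoexp x" for x
    using tppf_hypoexp by (intro tp_pos) (simp add: totally_positive_polya_frequency_def)
  have "tn (\<lambda>x. (10 powr \<alpha> / F 1) * F (hypoexp x))"
    using F_pos[of 1] by (intro tn_mult tn_transform tppf_hypoexp) simp
  then show ?thesis
    using F_pos[of 1] by (simp add: assms[OF pos] powr_mult less_imp_le[OF pos])
qed

text \<open>Any other exponent violates \<open>tn_expansion_sign\<close>: for
  \<open>\<alpha> < 1\<close> three terms have a positive product of coefficients and a negative
  determinant, for \<open>\<alpha> > 1\<close> four terms have the opposite signs.\<close>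

lemma F_linear:
  assumes "0 < u"
  shows "F u = F 1 * u"
proof -
  obtain \<alpha> where \<alpha>: "0 < \<alpha>" and F: "\<And>u. 0 < u \<Longrightarrow> F u = F 1 * u powr \<alpha>"
    using F_power by blast
  note tn = tn_hypoexp_powr[OF F]
  have "\<not> \<alpha> < 1"
  proof
    assume "\<alpha> < 1"
    define \<mu> where "\<mu> k = \<alpha> / 2 + 2 * real k" for k
    define p where "p k = [1, - (10 / 3) * \<alpha>, 50 / 9 * \<alpha> * (\<alpha> - 1)] ! k" for k
    have mu: "strict_mono_on {..<3} \<mu>" by (auto simp: \<mu>_def strict_mono_on_def)
    have "0 \<le> ndet 3 (\<lambda>i k. exp (- (real i * \<mu> k))) * (\<Prod>k<3. p k)"
    proof (rule tn_expansion_sign[OF tn mu])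
      show "((\<lambda>x. ((10 * hypoexp x) powr \<alpha> - (\<Sum>k<3. p k * exp (- \<mu> k * x)))
          * exp ((\<alpha> / 2 + 4) * x)) \<longlongrightarrow> 0) at_top"
      proof -
        have "(\<Sum>k<3. p k * exp (- \<mu> k * x)) = exp (- (\<alpha> / 2) * x)
            - 10 / 3 * \<alpha> * exp (- (\<alpha> / 2 + 2) * x)
            + 50 / 9 * \<alpha> * (\<alpha> - 1) * exp (- (\<alpha> / 2 + 4) * x)" for x
          by (simp add: eval_nat_numeral p_def \<mu>_def)
        then show ?thesis using hypoexp_powr_expansion_3[OF \<alpha> \<open>\<alpha> < 1\<close>] by (simp only:)
      qed
    qed (auto simp: \<mu>_def)
    moreover have "0 < (\<Prod>k<3. p k)"
      using \<alpha> \<open>\<alpha> < 1\<close> by (simp add: numeral_3_eq_3 p_def zero_less_mult_iff mult_less_0_iff)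
    ultimately show False
      using ndet_3_exp_reverse[OF mu] by (simp add: zero_le_mult_iff)
  qed
  moreover have "\<not> 1 < \<alpha>"
  proof
    assume "1 < \<alpha>"
    define \<mu> where "\<mu> k = \<alpha> / 2 + [0, 2, 4, 5] ! k" for k
    define p where "p k = [1, - (10 / 3) * \<alpha>, 50 / 9 * \<alpha> * (\<alpha> - 1), 80 * \<alpha>] ! k" for k
    have mu: "strict_mono_on {..<4} \<mu>"
      by (auto simp: \<mu>_def strict_mono_on_def less_Suc_eq eval_nat_numeral)
    have "0 \<le> ndet 4 (\<lambda>i k. exp (- (real i * \<mu> k))) * (\<Prod>k<4. p k)"
    proof (rule tn_expansion_sign[OF tn mu])
      show "((\<lambda>x. ((10 * hypoexp x) powr \<alpha> - (\<Sum>k<4. p k * exp (- \<mu> k * x)))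
          * exp ((\<alpha> / 2 + 5) * x)) \<longlongrightarrow> 0) at_top"
      proof -
        have "(\<Sum>k<4. p k * exp (- \<mu> k * x)) = exp (- (\<alpha> / 2) * x)
            - 10 / 3 * \<alpha> * exp (- (\<alpha> / 2 + 2) * x)
            + 50 / 9 * \<alpha> * (\<alpha> - 1) * exp (- (\<alpha> / 2 + 4) * x)
            + 80 * \<alpha> * exp (- (\<alpha> / 2 + 5) * x)" for x
          by (simp add: eval_nat_numeral p_def \<mu>_def)
        then show ?thesis using hypoexp_powr_expansion_4[OF \<open>1 < \<alpha>\<close>] by (simp only:)
      qed
    qed (auto simp: \<mu>_def less_Suc_eq eval_nat_numeral)
    moreover have "(\<Prod>k<4. p k) < 0"
      using \<open>1 < \<alpha>\<close> by (simp add: eval_nat_numeral p_def zero_less_mult_iff mult_less_0_iff)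
    ultimately show False
      using ndet_4_exp_reverse[OF mu] by (simp add: zero_le_mult_iff)
  qed
  ultimately have "\<alpha> = 1" by simp
  show ?thesis
    using F[OF assms] unfolding \<open>\<alpha> = 1\<close> powr_one[OF less_imp_le[OF assms]] .
qed

end

section \<open>The preserver theorem\<close>

lemma polya_frequency_mult:
  assumes "polya_frequency \<Lambda>" "0 < c"
  shows "polya_frequency (\<lambda>x. c * \<Lambda> x)"
  using assms unfolding polya_frequency_def by (auto intro: tn_mult)

lemma totally_positive_polya_frequency_mult:
  assumes "totally_positive_polya_frequency \<Lambda>" "0 < c"
  shows "totally_positive_polya_frequency (\<lambda>x. c * \<Lambda> x)"
  using assms polya_frequency_mult tp_exp_mult[of \<Lambda> c 0]
  unfolding totally_positive_polya_frequency_def by simp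

text \<open>The value at the discontinuity is that of the smooth functions approximating it.\<close>

lemma polya_frequency_one_sided_exp:
  "polya_frequency (\<lambda>x. if x < 0 then 0 else if x = 0 then 1 - exp (- 1) else exp (- x))"
    (is "polya_frequency ?e")
proof -
  define f where "f q x = 1 * exp (- x) * (1 - exp (- exp (q * x)))" for q x :: real
  have "tn ?e"
  proof (rule tn_limit[where F = at_top])
    show "\<forall>\<^sub>F q in at_top. tn (f q)"
      using eventually_gt_at_top[of 1]
    proof eventually_elim
      case (elim q)
      then have "totally_positive_polya_frequency (f q)"
        unfolding f_def[abs_def] by (intro tppf_smoothed_exp) auto
      then show ?case
        by (simp add: totally_positive_polya_frequency_def polya_frequency_def)
    qed
    show "((\<lambda>q. f q x) \<longlongrightarrow> ?e x) at_top" for x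
    proof (cases x "0::real" rule: linorder_cases)
      case less
      then have "((\<lambda>q. f q x) \<longlongrightarrow> 0) at_top" unfolding f_def by real_asymp
      then show ?thesis using less by simp
    next
      case equal
      then show ?thesis by (simp add: f_def)
    next
      case greater
      then have "((\<lambda>q. f q x) \<longlongrightarrow> exp (- x)) at_top" unfolding f_def by real_asymp
      then show ?thesis using greater by simp
    qed
  qed simp
  moreover have "integrable lebesgue ?e"
  proof -
    have "integrable lborel ?e"
    proof (rule Bochner_Integration.integrable_bound[OF integrable_lborel_exp_abs[of 1]])
      show "?e \<in> borel_measurable lborel" by measurable
      show "AE x in lborel. norm (?e x) \<le> norm (exp (- 1 * \<bar>x\<bar>))" by (intro AE_I2) auto
    qed simp
    then show ?thesis by (subst integrable_completion) auto
  qed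
  moreover have "\<exists>a b. a \<noteq> b \<and> ?e a \<noteq> 0 \<and> ?e b \<noteq> 0"
    by (rule exI[of _ 1], rule exI[of _ 2]) simp
  ultimately show ?thesis
    unfolding polya_frequency_def by simp
qed

text \<open>Totally positive functions never take the value 0, so \<open>F 0\<close> is tested on a
  one-sided exponential: the composition is integrable and constantly \<open>F 0\<close> on the
  negative half-line.\<close>

lemma polya_frequency_preserver_zero:
  assumes "\<And>\<Lambda>. polya_frequency \<Lambda> \<Longrightarrow> polya_frequency (F \<circ> \<Lambda>)" "0 \<le> F 0"
  shows "F 0 = 0"
proof -
  have pf: "polya_frequency (F \<circ> (\<lambda>x. if x < 0 then 0 else if x = 0 then 1 - exp (- 1) else exp (- x)))"
    by (rule assms(1)[OF polya_frequency_one_sided_exp])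
  have "F 0 \<le> 0"
    by (rule integrable_half_line_bound) (use pf in \<open>auto simp: polya_frequency_def\<close>)
  with assms(2) show ?thesis by simp
qed

theorem theorem1p4:
  "(\<forall>F :: real \<Rightarrow> real. F \<in> {0..} \<rightarrow> {0..} \<longrightarrow>
      ((\<forall>\<Lambda>. polya_frequency \<Lambda> \<longrightarrow> polya_frequency (F \<circ> \<Lambda>)) \<longleftrightarrow>
       (\<exists>c>0. \<forall>x\<ge>0. F x = c * x)))
   \<and>
   (\<forall>F :: real \<Rightarrow> real. F \<in> {0<..} \<rightarrow> {0<..} \<longrightarrow>
      ((\<forall>\<Lambda>. totally_positive_polya_frequency \<Lambda> \<longrightarrow>
             totally_positive_polya_frequency (F \<circ> \<Lambda>)) \<longleftrightarrow>
       (\<exists>c>0. \<forall>x>0. F x = c * x)))"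
proof (intro conjI allI impI iffI)
  fix F :: "real \<Rightarrow> real"
  assume F: "F \<in> {0..} \<rightarrow> {0..}" and pres: "\<forall>\<Lambda>. polya_frequency \<Lambda> \<longrightarrow> polya_frequency (F \<circ> \<Lambda>)"
  interpret polya_transform F
    by standard (use pres in \<open>simp add: totally_positive_polya_frequency_def\<close>)
  have "0 < F 1" by (rule F_pos) simp
  have "F 0 = 0"
    by (rule polya_frequency_preserver_zero) (use F pres in auto)
  have "F x = F 1 * x" if "0 \<le> x" for x
  proof (cases "x = 0")
    case False
    then show ?thesis using that by (intro F_linear) simp
  qed (simp add: \<open>F 0 = 0\<close>)
  then show "\<exists>c>0. \<forall>x\<ge>0. F x = c * x"
    using \<open>0 < F 1\<close> by (intro exI[of _ "F 1"] conjI allI impI)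
next
  fix F \<Lambda> :: "real \<Rightarrow> real"
  assume "\<exists>c>0. \<forall>x\<ge>0. F x = c * x" and \<Lambda>: "polya_frequency \<Lambda>"
  then obtain c where c: "0 < c" "\<And>x. 0 \<le> x \<Longrightarrow> F x = c * x" by blast
  have "F \<circ> \<Lambda> = (\<lambda>x. c * \<Lambda> x)"
    using \<Lambda> by (auto simp: polya_frequency_def c)
  then show "polya_frequency (F \<circ> \<Lambda>)"
    using polya_frequency_mult[OF \<Lambda> c(1)] by simp
next
  fix F :: "real \<Rightarrow> real"
  assume pres: "\<forall>\<Lambda>. totally_positive_polya_frequency \<Lambda> \<longrightarrow>
    totally_positive_polya_frequency (F \<circ> \<Lambda>)"
  interpret polya_transform F
    by standard (use pres in \<open>simp add: totally_positive_polya_frequency_def\<close>)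
  have "0 < F 1" by (rule F_pos) simp
  then show "\<exists>c>0. \<forall>x>0. F x = c * x"
    using F_linear by (intro exI[of _ "F 1"] conjI allI impI)
next
  fix F \<Lambda> :: "real \<Rightarrow> real"
  assume "\<exists>c>0. \<forall>x>0. F x = c * x" and \<Lambda>: "totally_positive_polya_frequency \<Lambda>"
  then obtain c where c: "0 < c" "\<And>x. 0 < x \<Longrightarrow> F x = c * x" by blast
  have "0 < \<Lambda> x" for x
    using \<Lambda> by (intro tp_pos) (simp add: totally_positive_polya_frequency_def)
  then have "F \<circ> \<Lambda> = (\<lambda>x. c * \<Lambda> x)"
    by (auto simp: c)
  then show "totally_positive_polya_frequency (F \<circ> \<Lambda>)"
    using totally_positive_polya_frequency_mult[OF \<Lambda> c(1)] by simp
qed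

end
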